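(* Let $d = 2$ and $w_{ij} = 1$ for all $i,j$. For $\varepsilon > 0$ and $\tau \in (-1,1)$ define $\varphi_{\varepsilon,\tau}(t) = \varepsilon \log\!\big(1 + e^{(t-\tau)/\varepsilon}\big)$; it is real-analytic with $\varphi_{\varepsilon,\tau}'(t) > 0$ and $\varphi_{\varepsilon,\tau}''(t) > 0$ for all $t$. There exist $\varepsilon > 0$ and $\tau \in (-1,1)$ such that, for every $n \geq 5$, the gradient flow $\dot X = \mathrm{grad} f(X)$ of $f(X) = \frac12 \sum_{i,j=1}^n \varphi_{\varepsilon,\tau}(x_i^\top x_j)$ on $(\mathbb{S}^1)^n$, started from a uniformly random initial point, converges with positive probability to a local maximum of $f$ which is not synchronized (i.e., not all $x_i$ equal).
   Context: $(\mathbb{S}^1)^n$ is the set of $X \in \mathbb{R}^{2\times n}$ with unit-norm columns $x_1,\dots,x_n$, a Riemannian submanifold of $\mathbb{R}^{2 \times n}$ with the Frobenius metric; $\mathrm{grad}$ is the Riemannian gradient. *)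

theory Defs
  imports "HOL-Analysis.Analysis" "HOL-Probability.Probability"
begin

text \<open>Configurations X in (S^1)^n are represented as maps nat => real^2 whose
  columns x_0, ..., x_{n-1} are the values X 0, ..., X (n-1) (values at i >= n are irrelevant).\<close>

definition phi :: "real \<Rightarrow> real \<Rightarrow> real \<Rightarrow> real" where
  "phi \<epsilon> \<tau> t = \<epsilon> * ln (1 + exp ((t - \<tau>) / \<epsilon>))"

definition torus :: "nat \<Rightarrow> (nat \<Rightarrow> real^2) set" where
  "torus n = {X. \<forall>i<n. norm (X i) = 1}"

definition obj :: "(real \<Rightarrow> real) \<Rightarrow> nat \<Rightarrow> (nat \<Rightarrow> real^2) \<Rightarrow> real" where
  "obj \<phi> n X = (1/2) * (\<Sum>i<n. \<Sum>j<n. \<phi> (X i \<bullet> X j))"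

definition egrad :: "((nat \<Rightarrow> real^2) \<Rightarrow> real) \<Rightarrow> (nat \<Rightarrow> real^2) \<Rightarrow> nat \<Rightarrow> real^2" where
  "egrad F X i = (THE D. GDERIV (\<lambda>v. F (X(i := v))) (X i) :> D)"

text \<open>Riemannian gradient on the Riemannian submanifold (S^1)^n of R^{2 x n}
  (Frobenius metric): orthogonal projection of the Euclidean gradient onto the
  tangent space, column-wise  g_i - (x_i . g_i) x_i.\<close>
definition rgrad :: "((nat \<Rightarrow> real^2) \<Rightarrow> real) \<Rightarrow> (nat \<Rightarrow> real^2) \<Rightarrow> nat \<Rightarrow> real^2" where
  "rgrad F X i = egrad F X i - (X i \<bullet> egrad F X i) *\<^sub>R X i"

definition grad_flow_sol ::
  "nat \<Rightarrow> ((nat \<Rightarrow> real^2) \<Rightarrow> real) \<Rightarrow> (nat \<Rightarrow> real^2) \<Rightarrow> (real \<Rightarrow> nat \<Rightarrow> real^2) \<Rightarrow> bool" where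
  "grad_flow_sol n F X0 \<gamma> \<longleftrightarrow>
     (\<forall>i<n. \<gamma> 0 i = X0 i) \<and>
     (\<forall>t\<ge>0. \<gamma> t \<in> torus n) \<and>
     (\<forall>t\<ge>0. \<forall>i<n. ((\<lambda>s. \<gamma> s i) has_vector_derivative rgrad F (\<gamma> t) i) (at t within {0..}))"

definition converges_to :: "nat \<Rightarrow> (real \<Rightarrow> nat \<Rightarrow> real^2) \<Rightarrow> (nat \<Rightarrow> real^2) \<Rightarrow> bool" where
  "converges_to n \<gamma> Xs \<longleftrightarrow> (\<forall>i<n. ((\<lambda>t. \<gamma> t i) \<longlongrightarrow> Xs i) at_top)"

definition fdist :: "nat \<Rightarrow> (nat \<Rightarrow> real^2) \<Rightarrow> (nat \<Rightarrow> real^2) \<Rightarrow> real" where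
  "fdist n X Y = sqrt (\<Sum>i<n. (norm (X i - Y i))\<^sup>2)"

definition local_max_on_torus :: "nat \<Rightarrow> ((nat \<Rightarrow> real^2) \<Rightarrow> real) \<Rightarrow> (nat \<Rightarrow> real^2) \<Rightarrow> bool" where
  "local_max_on_torus n F Xs \<longleftrightarrow> Xs \<in> torus n \<and>
     (\<exists>\<delta>>0. \<forall>Y\<in>torus n. fdist n Y Xs < \<delta> \<longrightarrow> F Y \<le> F Xs)"

definition synchronized :: "nat \<Rightarrow> (nat \<Rightarrow> real^2) \<Rightarrow> bool" where
  "synchronized n X \<longleftrightarrow> (\<forall>i<n. \<forall>j<n. X i = X j)"

definition circ :: "real \<Rightarrow> real^2" where
  "circ t = vector [cos t, sin t]"

definition unif_torus :: "nat \<Rightarrow> (nat \<Rightarrow> real^2) measure" where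
  "unif_torus n = distr (PiM {..<n} (\<lambda>_. uniform_measure lborel {0..2*pi}))
                        (PiM {..<n} (\<lambda>_. borel))
                        (\<lambda>\<theta>. \<lambda>i\<in>{..<n}. circ (\<theta> i))"

end

(*
  Write h(s) = phi (cos s).  In angles the flow is the gradient flow of
  1/2 sum_{i,j} h(theta_i - theta_j).  For 0 < tau < cos (2 pi / 5) and small epsilon, phi' is nearly 1
  above tau and nearly 0 below it, so h'' is clearly negative at differences with cosine above tau
  (call such pairs edges) and negligible at differences with cosine below tau.  Hence near
  a configuration whose edge graph is connected and where no cosine equals tau the objective is
  strictly concave modulo rotations, with a constant given by a Poincare inequality for the graph.
  If moreover the gradient there is small against that constant, there is a critical point nearby; it
  is a local maximum attracting, up to rotation, an open set of initial angles exponentially fast.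

  For n below a threshold N the configuration is the regular n-gon, whose gradient vanishes by
  symmetry.  For fixed epsilon and tau this cannot work for all n, so for n >= N the points are spread over
  the vertices of a regular pentagon: the cluster sizes differ by at most one, the gradient is
  O(sqrt n) while the concavity constant is of order n.  The threshold N depends only on
  cos (2 pi / 5), so tau can be chosen to avoid the finitely many cosines occurring in the n-gons with
  n < N, and epsilon afterwards.
*)

theory Submission
  imports Defs "HOL-Real_Asymp.Real_Asymp"
begin

section \<open>Global solutions of bounded Lipschitz systems\<close>

text \<open>Edges need positive cosines, since on them the limiting second derivative of
  \<open>h\<close> is minus the cosine; \<open>n \<ge> 5\<close> is exactly when neighbouring
  vertices of the regular n-gon are less than a quarter turn apart. As n grows the cosines of the
  n-gon become dense, so some come within epsilon of tau, where phi'' is of order 1/epsilon and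
  destabilises. The pentagon has only three cosines whatever n is, but unequal clusters leave a
  nonzero force, which only a large n absorbs. The statement speaks of every curve that solves the
  flow, and such a curve carries no angles. So existence is proved in angles and uniqueness for
  vectors; a lift to angles is needed only for initial points and for competitors near the maximum.
  Critical points come in circles of rotated copies. The sum of the angles is conserved and selects
  the copy that a solution approaches. Positive probability is witnessed by a product of arcs: it is
  measurable, has positive measure and consists of good initial points.\<close>

lemma continuous_on_discrete_times:
  fixes f :: "'a discrete \<times> real \<Rightarrow> real"
  assumes "\<And>i. continuous_on UNIV (\<lambda>t. f (i, t))"
  shows "continuous_on UNIV f"
proof -
  \<comment> \<open>The slices are open because the first factor is discrete, so continuity can be
    checked on each of them separately.\<close>
  have "continuous_on (\<Union>i. {i} \<times> (UNIV::real set)) f"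
  proof (rule continuous_on_open_UN)
    show "open ({i} \<times> (UNIV::real set))" for i :: "'a discrete"
      by (intro open_Times Discrete_Topology.open_discrete open_UNIV)
    show "continuous_on ({i} \<times> (UNIV::real set)) f" for i :: "'a discrete"
    proof -
      have "continuous_on ({i} \<times> (UNIV::real set)) (\<lambda>p. f (i, snd p))"
        by (rule continuous_on_compose2[OF assms]) (auto intro: continuous_intros)
      then show ?thesis
        by (rule continuous_on_eq) auto
    qed
  qed
  moreover have "(\<Union>i. {i} \<times> (UNIV::real set)) = (UNIV :: ('a discrete \<times> real) set)"
    by auto
  ultimately show ?thesis by simp
qed

text \<open>The curves are rescaled by \<open>exp (- \<lambda> t)\<close> with \<open>\<lambda> = 2 L\<close>, which makes the Picard
  operator a contraction on all of \<open>[0, \<infinity>)\<close> at once; taking \<open>nat discrete \<times> real\<close> as the domain of the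
  bounded continuous functions lets the dimension \<open>n\<close> be a term.\<close>

lemma bounded_lipschitz_ode_solution:
  fixes F :: "nat \<Rightarrow> (nat \<Rightarrow> real) \<Rightarrow> real" and a :: "nat \<Rightarrow> real"
  assumes bd: "\<And>i x. i < n \<Longrightarrow> \<bar>F i x\<bar> \<le> M"
    and lip: "\<And>i x y D. i < n \<Longrightarrow> (\<And>j. j < n \<Longrightarrow> \<bar>x j - y j\<bar> \<le> D) \<Longrightarrow> \<bar>F i x - F i y\<bar> \<le> L * D"
    and L: "L > 0"
  obtains \<theta> where "\<theta> 0 = a"
    and "\<And>i t. i < n \<Longrightarrow> t \<ge> 0 \<Longrightarrow>
           ((\<lambda>s. \<theta> s i) has_real_derivative F i (\<theta> t)) (at t within {0..})"
proof -
  \<comment> \<open>The integral of \<open>L * exp (l * s)\<close> over \<open>{0..t}\<close> is at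
    most \<open>L / l * exp (l * t)\<close>, so the contraction factor is \<open>L / l\<close>, here
    1/2.\<close>
  define l where "l = 2 * L"
  have l: "l > 0" using L by (simp add: l_def)
  define x where "x u t j = a j + exp (l * t) * apply_bcontfun u (discrete j, t)" for u :: "(nat discrete \<times> real) \<Rightarrow>\<^sub>C real" and t j
  \<comment> \<open>Bounded continuous functions live on all real times; \<open>max 0\<close> makes
    the rescaled Picard operator vanish at the negative ones.\<close>
  define P where "P u i t = integral {0..max 0 t} (\<lambda>s. F i (x u s))" for u i and t :: real
  define T where "T u p = (if of_discrete (fst p) < n then exp (- l * max 0 (snd p)) * P u (of_discrete (fst p)) (snd p) else 0)" for u and p :: "nat discrete \<times> real"
  have contu: "continuous_on S (\<lambda>t. apply_bcontfun u (discrete j, t))" for u :: "(nat discrete \<times> real) \<Rightarrow>\<^sub>C real" and S j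
    by (rule continuous_on_compose2[OF continuous_on_apply_bcontfun, of _ "\<lambda>t. (discrete j,t)"])
      (auto intro!: continuous_intros)
  have contx: "continuous_on S (\<lambda>t. x u t j)" for u S j
    unfolding x_def by (intro continuous_intros contu)
  have contF: "continuous_on UNIV (\<lambda>t. F i (x u t))" if "i < n" for i u
    unfolding continuous_on_def
  proof
    fix t :: real
    have "((\<lambda>s. L * (\<Sum>j<n. \<bar>x u s j - x u t j\<bar>)) \<longlongrightarrow> L * (\<Sum>j<n. \<bar>x u t j - x u t j\<bar>)) (at t)"
      using contx[of UNIV u, unfolded continuous_on_def] by (intro tendsto_intros) auto
    then have "((\<lambda>s. L * (\<Sum>j<n. \<bar>x u s j - x u t j\<bar>)) \<longlongrightarrow> 0) (at t)" by simp
    moreover have "\<forall>s. norm (F i (x u s) - F i (x u t)) \<le> L * (\<Sum>j<n. \<bar>x u s j - x u t j\<bar>)"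
      using that by (auto intro!: lip member_le_sum)
    ultimately have "((\<lambda>s. F i (x u s) - F i (x u t)) \<longlongrightarrow> 0) (at t)"
      by (rule Lim_null_comparison[OF always_eventually, rotated])
    then show "((\<lambda>s. F i (x u s)) \<longlongrightarrow> F i (x u t)) (at t within UNIV)"
      by (simp add: Lim_null[symmetric])
  qed
  have intF: "(\<lambda>s. F i (x u s)) integrable_on {b..c}" if "i < n" for i u b c
    using contF[OF that] by (intro integrable_continuous_real) (auto intro: continuous_on_subset)
  have M: "M \<ge> 0 \<or> n = 0" using bd by (metis abs_ge_zero gr0I order_trans)
  have T: "T u \<in> bcontfun" for u
    unfolding bcontfun_def
  proof (safe)
    show "continuous_on UNIV (T u)"
    proof (rule continuous_on_discrete_times)
      fix i
      show "continuous_on UNIV (\<lambda>t. T u (i, t))"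
      proof (cases "of_discrete i < n")
        case True
        have *: "continuous_on {0..b} (\<lambda>t. integral {0..t} (\<lambda>s. F (of_discrete i) (x u s)))" for b
          by (rule indefinite_integral_continuous_1[OF intF[OF True]])
        have **: "continuous_on {0..} (\<lambda>t. integral {0..t} (\<lambda>s. F (of_discrete i) (x u s)))"
          unfolding continuous_on_eq_continuous_within
        proof
          fix t :: real assume t: "t \<in> {0..}"
          have "continuous (at t within {0..t+1}) (\<lambda>t. integral {0..t} (\<lambda>s. F (of_discrete i) (x u s)))"
            using *[of "t+1"] t by (auto simp: continuous_on_eq_continuous_within)
          moreover have "at t within {0..t+1} = at t within {0..}"
            using t by (intro at_within_nhd[of _ "{..<t+1}"]) auto
          ultimately show "continuous (at t within {0..}) (\<lambda>t. integral {0..t} (\<lambda>s. F (of_discrete i) (x u s)))"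
            by (simp add: continuous_within)
        qed
        have "continuous_on UNIV (P u (of_discrete i))"
          unfolding P_def
          by (rule continuous_on_compose2[OF **, of UNIV "\<lambda>t. max 0 t"]) (auto intro!: continuous_intros)
        then show ?thesis using True
          unfolding T_def by (auto intro!: continuous_intros)
      qed (simp add: T_def)
    qed
    have "norm (T u p) \<le> (if n = 0 then 0 else M / l)" for p
    proof (cases "of_discrete (fst p) < n")
      case True
      define t where "t = max 0 (snd p)"
      have t: "t \<ge> 0" by (simp add: t_def)
      have "\<bar>P u (of_discrete (fst p)) (snd p)\<bar> \<le> integral {0..t} (\<lambda>_. M)"
        unfolding P_def t_def[symmetric] real_norm_def[symmetric]
        by (rule integral_norm_bound_integral) (use True intF bd in auto)
      then have "\<bar>P u (of_discrete (fst p)) (snd p)\<bar> \<le> t * M" using t by simp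
      \<comment> \<open>The integral grows at most linearly and the weight dominates this, so the
        rescaled image is bounded by \<open>M / l\<close>.\<close>
      moreover have "t \<le> exp (l * t) / l"
      proof -
        have "l * t \<le> exp (l * t)" using exp_ge_add_one_self[of "l*t"] by linarith
        then show ?thesis using l by (simp add: field_simps)
      qed
      ultimately have "\<bar>P u (of_discrete (fst p)) (snd p)\<bar> \<le> exp (l * t) / l * M"
        using M True by (smt (verit) mult_right_mono not_less0)
      then have "exp (- l * t) * \<bar>P u (of_discrete (fst p)) (snd p)\<bar> \<le> exp (- l * t) * (exp (l * t) / l * M)"
        by (intro mult_left_mono) auto
      also have "\<dots> = M / l"
        by (simp add: exp_minus field_simps)
      finally show ?thesis using True by (simp add: T_def t_def abs_mult)
    qed (use M l in \<open>auto simp: T_def\<close>)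
    then show "bounded (range (T u))" by (auto simp: bounded_iff)
  qed
  have contr: "dist (Bcontfun (T u)) (Bcontfun (T w)) \<le> (1/2) * dist u w" for u w
  proof (rule dist_bound)
    fix p :: "nat discrete \<times> real"
    show "dist (apply_bcontfun (Bcontfun (T u)) p) (apply_bcontfun (Bcontfun (T w)) p) \<le> 1/2 * dist u w"
    proof (cases "of_discrete (fst p) < n")
      case True
      define t where "t = max 0 (snd p)"
      have t: "t \<ge> 0" by (simp add: t_def)
      define D where "D = dist u w"
      have *: "\<bar>F (of_discrete (fst p)) (x u s) - F (of_discrete (fst p)) (x w s)\<bar> \<le> L * (exp (l * s) * D)" for s
      proof (rule lip[OF True])
        fix j
        have "\<bar>apply_bcontfun u (discrete j, s) - apply_bcontfun w (discrete j, s)\<bar> \<le> D"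
          using dist_bounded[of u "(discrete j,s)" w] by (simp add: D_def dist_real_def)
        moreover have "\<bar>x u s j - x w s j\<bar> = exp (l * s) * \<bar>apply_bcontfun u (discrete j, s) - apply_bcontfun w (discrete j, s)\<bar>"
          by (simp add: x_def abs_mult flip: right_diff_distrib)
        ultimately show "\<bar>x u s j - x w s j\<bar> \<le> exp (l * s) * D" by simp
      qed
      have hi: "((\<lambda>s. L * (exp (l * s) * D)) has_integral (L * D / l * exp (l * t) - L * D / l * exp (l * 0))) {0..t}"
        using t l by (intro fundamental_theorem_of_calculus)
          (auto intro!: derivative_eq_intros simp flip: has_real_derivative_iff_has_vector_derivative)
      have "P u (of_discrete (fst p)) (snd p) - P w (of_discrete (fst p)) (snd p) = integral {0..t} (\<lambda>s. F (of_discrete (fst p)) (x u s) - F (of_discrete (fst p)) (x w s))"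
        unfolding P_def t_def[symmetric] by (rule integral_diff[symmetric]) (use intF True in auto)
      then have "\<bar>P u (of_discrete (fst p)) (snd p) - P w (of_discrete (fst p)) (snd p)\<bar> \<le> integral {0..t} (\<lambda>s. L * (exp (l * s) * D))"
        using * hi by (simp only: real_norm_def[symmetric])
          (rule integral_norm_bound_integral, use True intF in \<open>auto intro!: integrable_diff\<close>)
      also have "\<dots> \<le> L * D / l * exp (l * t)"
        using integral_unique[OF hi] L l by (simp add: D_def)
      finally have "exp (- l * t) * \<bar>P u (of_discrete (fst p)) (snd p) - P w (of_discrete (fst p)) (snd p)\<bar> \<le> exp (- l * t) * (L * D / l * exp (l * t))"
        by (intro mult_left_mono) auto
      also have "\<dots> = 1/2 * D" using L by (simp add: exp_minus field_simps l_def)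
      finally show ?thesis using True
        by (simp add: Bcontfun_inverse T T_def t_def D_def dist_real_def abs_mult flip: right_diff_distrib)
    qed (simp add: Bcontfun_inverse T T_def)
  qed
  obtain u where u: "Bcontfun (T u) = u"
    using banach_fix_type[of "1/2" "\<lambda>u. Bcontfun (T u)"] contr by auto
  have "apply_bcontfun u p = T u p" for p
    by (metis u Bcontfun_inverse T)
  then have xu: "x u t i = a i + P u i t" if "i < n" "t \<ge> 0" for i t
    using that by (simp add: x_def T_def exp_minus discrete_inverse)
  have deriv: "((\<lambda>s. x u s i) has_real_derivative F i (x u t)) (at t within {0..})" if "i < n" "t \<ge> 0" for i t
  proof -
    have "((\<lambda>s. integral {0..s} (\<lambda>s. F i (x u s))) has_real_derivative F i (x u t)) (at t within {0..t+1})"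
      using that by (intro integral_has_real_derivative continuous_on_subset[OF contF]) auto
    moreover have "at t within {0..t+1} = at t within {0..}"
      using that by (intro at_within_nhd[of _ "{..<t+1}"]) auto
    ultimately have "((\<lambda>s. a i + integral {0..s} (\<lambda>s. F i (x u s))) has_real_derivative F i (x u t)) (at t within {0..})"
      by (auto intro!: derivative_eq_intros)
    then show ?thesis
      by (rule has_field_derivative_transform_within[of _ _ _ _ 1]) (use that xu in \<open>auto simp: P_def\<close>)
  qed
  define \<theta> where "\<theta> t = (if t = 0 then a else x u t)" for t
  have \<theta>x: "\<theta> t i = x u t i" if "i < n" for t i
    using that xu[of i 0] by (auto simp: \<theta>_def P_def)
  \<comment> \<open>Taking \<open>D = 0\<close> in the Lipschitz hypothesis shows that
    \<open>F i\<close> depends only on the coordinates below \<open>n\<close>.\<close>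
  have F\<theta>: "F i (\<theta> t) = F i (x u t)" if "i < n" for t i
    using lip[OF that, of "\<theta> t" "x u t" 0] \<theta>x by auto
  show thesis
    using deriv by (intro that[of \<theta>]) (auto simp: \<theta>x F\<theta> \<theta>_def[of 0])
qed

section \<open>Attraction to critical points in a region of concavity\<close>

text \<open>The product \<open>u t * exp (- k * t)\<close> is nonincreasing. The inequality is asked
  only on the open interval, where the one-sided derivative is an ordinary one; continuity covers
  the end points. The sign of \<open>k\<close> is free: negative for decay towards a critical point,
  nonnegative for uniqueness.\<close>

lemma gronwall_exp_bound:
  fixes u u' :: "real \<Rightarrow> real"
  assumes d: "\<And>t. t \<ge> 0 \<Longrightarrow> (u has_real_derivative u' t) (at t within {0..})"
    and t: "t \<ge> 0"
    and le: "\<And>s. 0 < s \<Longrightarrow> s < t \<Longrightarrow> u' s \<le> k * u s"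
  shows "u t \<le> u 0 * exp (k * t)"
proof -
  have cont: "continuous_on {0..} u"
    unfolding continuous_on_eq_continuous_within by (auto intro: DERIV_continuous[OF d])
  have d': "(u has_real_derivative u' t) (at t)" if "t > 0" for t
    using d[of t] that at_within_interior[of t "{0..}"] by (simp add: interior_Ici)
  have "u t * exp (- k * t) \<le> u 0 * exp (- k * 0)"
  proof (rule DERIV_nonpos_imp_decreasing_open[OF t])
    fix s assume s: "0 < s" "s < t"
    have "((\<lambda>t. u t * exp (- k * t)) has_real_derivative (u' s - k * u s) * exp (- k * s)) (at s)"
      using d'[of s] s by (auto intro!: derivative_eq_intros simp: algebra_simps)
    moreover have "(u' s - k * u s) * exp (- k * s) \<le> 0"
      using le[of s] s by (intro mult_nonpos_nonneg) auto
    ultimately show "\<exists>y. ((\<lambda>t. u t * exp (- k * t)) has_real_derivative y) (at s) \<and> y \<le> 0"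
      by blast
  qed (auto intro!: continuous_intros continuous_on_subset[OF cont])
  then show ?thesis by (simp add: exp_minus field_simps)
qed

text \<open>The differential inequality is known only while \<open>u\<close> is below
  \<open>R\<close>. At a first time \<open>T\<close> with \<open>u T \<ge> R\<close> the function
  would have been nonincreasing up to \<open>T\<close>, so \<open>u T \<le> u 0 < R\<close>. Hence
  the barrier is never reached and the Gronwall bound holds for all times.\<close>

lemma exp_decay_below_barrier:
  fixes u u' :: "real \<Rightarrow> real"
  assumes d: "\<And>t. t \<ge> 0 \<Longrightarrow> (u has_real_derivative u' t) (at t within {0..})"
    and le: "\<And>t. t \<ge> 0 \<Longrightarrow> u t < R \<Longrightarrow> u' t \<le> - k * u t"
    and nonneg: "\<And>t. t \<ge> 0 \<Longrightarrow> u t \<ge> 0"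
    and u0: "u 0 < R" and k: "k \<ge> 0" and t: "t \<ge> 0"
  shows "u t \<le> u 0 * exp (- k * t)"
proof -
  have cont: "continuous_on {0..} u"
    unfolding continuous_on_eq_continuous_within by (auto intro: DERIV_continuous[OF d])
  have d': "(u has_real_derivative u' t) (at t)" if "t > 0" for t
    using d[of t] that at_within_interior[of t "{0..}"] by (simp add: interior_Ici)
  have bar: "u t < R" if "t \<ge> 0" for t
  proof (rule ccontr)
    assume neg: "\<not> u t < R"
    define S where "S = {0..} \<inter> u -` {R..}"
    have S: "closed S" unfolding S_def
      by (rule continuous_closed_preimage[OF cont]) auto
    have ne: "S \<noteq> {}" and bb: "bdd_below S"
      using neg that by (auto simp: S_def bdd_below_def)
    define T where "T = Inf S"
    have T: "T \<in> S" unfolding T_def by (rule closed_contains_Inf[OF ne bb S])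
    have below: "u s < R" if "0 \<le> s" "s < T" for s
      using cInf_lower[OF _ bb, of s] that by (force simp: S_def T_def)
    have T0: "T > 0" using T u0 by (cases "T = 0") (auto simp: S_def)
    have "u T \<le> u 0"
    proof (rule DERIV_nonpos_imp_decreasing_open[OF less_imp_le[OF T0]])
      fix s assume s: "0 < s" "s < T"
      have "u' s \<le> - k * u s" using le[of s] below[of s] s by simp
      also have "\<dots> \<le> 0" using k nonneg[of s] s by simp
      finally show "\<exists>y. (u has_real_derivative y) (at s) \<and> y \<le> 0"
        using d'[of s] s by auto
    qed (use cont in \<open>auto intro: continuous_on_subset\<close>)
    then show False using T u0 by (auto simp: S_def)
  qed
  show ?thesis
    using le bar by (intro gronwall_exp_bound[OF d t]) auto
qed

text \<open>The Laplacian of the complete graph is \<open>n\<close> times the identity on mean-zero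
  vectors. This turns coercivity in pairwise differences into coercivity in the Euclidean
  norm.\<close>

lemma sum_sq_diff_of_sum_zero:
  fixes v :: "nat \<Rightarrow> real"
  assumes "(\<Sum>i<n. v i) = 0"
  shows "(\<Sum>i<n. \<Sum>j<n. (v i - v j)\<^sup>2) = 2 * real n * (\<Sum>i<n. (v i)\<^sup>2)"
proof -
  have "(\<Sum>i<n. \<Sum>j<n. (v i - v j)\<^sup>2)
      = (\<Sum>i<n. \<Sum>j<n. (v i)\<^sup>2) + (\<Sum>i<n. \<Sum>j<n. (v j)\<^sup>2) - 2 * (\<Sum>i<n. \<Sum>j<n. v i * v j)"
    by (simp add: power2_diff sum.distrib sum_subtractf sum_distrib_left mult.assoc)
  also have "(\<Sum>i<n. \<Sum>j<n. v i * v j) = 0"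
    using assms by (simp flip: sum_product)
  finally show ?thesis by (simp add: sum_distrib_left mult.assoc)
qed

text \<open>A closed subset of a Tychonoff cube. Freezing the coordinates from \<open>n\<close> on
  gives compactness in the function space, and the mean-zero condition removes the direction of
  rotations.\<close>

lemma compact_sum_zero_ball:
  "compact {v :: nat \<Rightarrow> real. (\<forall>i\<ge>n. v i = 0) \<and> (\<Sum>i<n. v i) = 0 \<and> (\<Sum>i<n. (v i)\<^sup>2) \<le> r\<^sup>2}" (is "compact ?K")
proof -
  have "compactin (product_topology (\<lambda>_. euclidean) UNIV) (PiE UNIV (\<lambda>_::nat. {- \<bar>r\<bar> .. \<bar>r\<bar>}))"
    by (subst compactin_PiE) (simp add: compactin_euclidean_iff)
  then have c: "compact (PiE UNIV (\<lambda>_::nat. {- \<bar>r\<bar> .. \<bar>r\<bar>}))"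
    by (simp add: euclidean_product_topology flip: compactin_euclidean_iff)
  have "closed (\<Inter>i\<in>{n..}. {v :: nat \<Rightarrow> real. v i = 0})"
    by (intro closed_INT ballI closed_Collect_eq continuous_intros)
       (auto intro: continuous_on_product_coordinates)
  moreover have "closed {v :: nat \<Rightarrow> real. (\<Sum>i<n. v i) = 0}"
    by (intro closed_Collect_eq continuous_intros) (auto intro: continuous_on_product_coordinates)
  moreover have "closed {v :: nat \<Rightarrow> real. (\<Sum>i<n. (v i)\<^sup>2) \<le> r\<^sup>2}"
    by (intro closed_Collect_le continuous_intros) (auto intro: continuous_on_product_coordinates)
  ultimately have "closed ((\<Inter>i\<in>{n..}. {v. v i = 0}) \<inter> {v. (\<Sum>i<n. v i) = 0} \<inter> {v :: nat \<Rightarrow> real. (\<Sum>i<n. (v i)\<^sup>2) \<le> r\<^sup>2})"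
    by (intro closed_Int)
  moreover have "(\<Inter>i\<in>{n..}. {v. v i = 0}) \<inter> {v. (\<Sum>i<n. v i) = 0} \<inter> {v :: nat \<Rightarrow> real. (\<Sum>i<n. (v i)\<^sup>2) \<le> r\<^sup>2} = ?K"
    by auto
  ultimately have cl: "closed ?K" by simp
  have "?K \<subseteq> PiE UNIV (\<lambda>_::nat. {- \<bar>r\<bar> .. \<bar>r\<bar>})"
  proof
    fix v assume v: "v \<in> ?K"
    have "\<bar>v i\<bar> \<le> \<bar>r\<bar>" for i
    proof (cases "i < n")
      case True
      then have "(v i)\<^sup>2 \<le> (\<Sum>i<n. (v i)\<^sup>2)" by (intro member_le_sum) auto
      also have "\<dots> \<le> r\<^sup>2" using v by simp
      finally show ?thesis by (simp add: abs_le_square_iff)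
    qed (use v in auto)
    then show "v \<in> PiE UNIV (\<lambda>_::nat. {- \<bar>r\<bar> .. \<bar>r\<bar>})"
      by (auto simp: abs_le_iff minus_le_iff)
  qed
  then show ?thesis using compact_Int_closed[OF c cl] by (simp add: Int_absorb1)
qed

section \<open>Energy of an even pair interaction and its second-order bounds\<close>

locale interaction =
  fixes h h1 h2 :: "real \<Rightarrow> real"
  assumes dh: "\<And>s. (h has_real_derivative h1 s) (at s)"
    and dh1: "\<And>s. (h1 has_real_derivative h2 s) (at s)"
    and odd: "\<And>s. h1 (- s) = - h1 s"
begin

definition energy :: "nat \<Rightarrow> (nat \<Rightarrow> real) \<Rightarrow> real" where
  "energy n \<theta> = (1/2) * (\<Sum>i<n. \<Sum>j<n. h (\<theta> i - \<theta> j))"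

definition force :: "nat \<Rightarrow> nat \<Rightarrow> (nat \<Rightarrow> real) \<Rightarrow> real" where
  "force n i \<theta> = (\<Sum>j<n. h1 (\<theta> i - \<theta> j))"

text \<open>The derivative of \<open>energy n\<close> at \<open>\<theta>\<close> in the direction
  \<open>v\<close>. In the pairwise form it visibly ignores constants added to
  \<open>\<theta>\<close> or to \<open>v\<close>, and curvature bounds apply term by term.\<close>

definition slope :: "nat \<Rightarrow> (nat \<Rightarrow> real) \<Rightarrow> (nat \<Rightarrow> real) \<Rightarrow> real" where
  "slope n \<theta> v = (1/2) * (\<Sum>i<n. \<Sum>j<n. h1 (\<theta> i - \<theta> j) * (v i - v j))"

lemma h1_swap: "h1 (a - b) = - h1 (b - a)"
  using odd[of "b - a"] by simp

lemma slope_eq_force: "slope n \<theta> v = (\<Sum>i<n. v i * force n i \<theta>)"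
proof -
  have "(\<Sum>i<n. \<Sum>j<n. h1 (\<theta> i - \<theta> j) * v j) = (\<Sum>j<n. \<Sum>i<n. h1 (\<theta> i - \<theta> j) * v j)"
    by (rule sum.swap)
  also have "\<dots> = - (\<Sum>i<n. \<Sum>j<n. h1 (\<theta> i - \<theta> j) * v i)"
    unfolding sum_negf[symmetric] by (intro sum.cong refl) (subst h1_swap, simp)
  finally have "(\<Sum>i<n. \<Sum>j<n. h1 (\<theta> i - \<theta> j) * (v i - v j)) = 2 * (\<Sum>i<n. \<Sum>j<n. h1 (\<theta> i - \<theta> j) * v i)"
    by (simp add: right_diff_distrib sum_subtractf)
  then show ?thesis
    by (simp add: slope_def force_def sum_distrib_left mult.commute)
qed

text \<open>Rotation invariance, in the form that makes the sum of the angles a conserved quantity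
  of the flow.\<close>

lemma sum_force: "(\<Sum>i<n. force n i \<theta>) = 0"
  using slope_eq_force[of n \<theta> "\<lambda>_. 1"] by (simp add: slope_def)

text \<open>Mean value theorem. The extra factor \<open>u\<close> lets a one-sided bound on
  \<open>h2\<close> serve for both signs of \<open>u\<close>.\<close>

lemma h1_increment_le:
  assumes "\<And>s. min a (a + u) \<le> s \<Longrightarrow> s \<le> max a (a + u) \<Longrightarrow> h2 s \<le> k"
  shows "(h1 (a + u) - h1 a) * u \<le> k * u\<^sup>2"
proof (cases "u = 0")
  case False
  have "\<exists>s. min a (a + u) \<le> s \<and> s \<le> max a (a + u) \<and> h1 (a + u) - h1 a = u * h2 s"
  proof (cases "u > 0")
    case True
    have "\<exists>z>a. z < a + u \<and> h1 (a + u) - h1 a = (a + u - a) * h2 z"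
      using True dh1 by (intro MVT2) auto
    then obtain z where "z > a" "z < a + u" "h1 (a + u) - h1 a = (a + u - a) * h2 z" by blast
    then show ?thesis using True by (intro exI[of _ z]) auto
  next
    case u: False
    have "\<exists>z>a + u. z < a \<and> h1 a - h1 (a + u) = (a - (a + u)) * h2 z"
      using u False dh1 by (intro MVT2) auto
    then obtain z where "z > a + u" "z < a" "h1 a - h1 (a + u) = (a - (a + u)) * h2 z" by blast
    then show ?thesis using u by (intro exI[of _ z]) (auto simp: algebra_simps)
  qed
  then obtain s where "h2 s \<le> k" "h1 (a + u) - h1 a = u * h2 s" using assms by blast
  then show ?thesis using mult_right_mono[of "h2 s" k "u * u"]
    by (simp add: power2_eq_square mult.assoc mult.left_commute)
qed simp

lemma continuous_on_h: "continuous_on S f \<Longrightarrow> continuous_on S (\<lambda>x. h (f x))"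
  by (rule continuous_on_compose2[of UNIV h])
     (auto intro: DERIV_continuous_on has_field_derivative_at_within dh)

lemma h_increment_le:
  assumes "\<And>s. min a (a + u) \<le> s \<Longrightarrow> s \<le> max a (a + u) \<Longrightarrow> h2 s \<le> k"
  shows "h (a + u) \<le> h a + h1 a * u + k * u\<^sup>2 / 2"
proof -
  \<comment> \<open>Here \<open>g\<close> is \<open>h\<close> along the segment minus its linear and
    quadratic terms. That its derivative is at most 0 is \<open>h1_increment_le\<close> for the
    increment \<open>s * u\<close>, divided by \<open>s\<close>.\<close>
  define g where "g s = h (a + s * u) - s * (h1 a * u) - k * u\<^sup>2 * s\<^sup>2 / 2" for s
  have "g 1 \<le> g 0"
  proof (rule DERIV_nonpos_imp_decreasing_open[of 0 1])
    fix s :: real assume s: "0 < s" "s < 1"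
    have "(g has_real_derivative (h1 (a + s * u) - h1 a) * u - k * u\<^sup>2 * s) (at s)"
      unfolding g_def by (auto intro!: derivative_eq_intros DERIV_chain'[OF _ dh] simp: algebra_simps)
    moreover have "(h1 (a + s * u) - h1 a) * u \<le> k * u\<^sup>2 * s"
    proof -
      have m: "min a (a + u) \<le> min a (a + s * u)" "max a (a + s * u) \<le> max a (a + u)"
        using s mult_right_le_one_le[of u s] mult_right_le_one_le[of "-u" s]
        by (cases "u \<ge> 0"; auto simp: min_def max_def mult.commute zero_le_mult_iff mult_le_0_iff)+
      have "(h1 (a + s * u) - h1 a) * (s * u) \<le> k * (s * u)\<^sup>2"
        using m by (intro h1_increment_le assms) linarith+
      then have "s * ((h1 (a + s * u) - h1 a) * u) \<le> s * (k * u\<^sup>2 * s)"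
        by (simp add: power2_eq_square algebra_simps)
      then show ?thesis using s by simp
    qed
    ultimately show "\<exists>y. (g has_real_derivative y) (at s) \<and> y \<le> 0" by force
  next
    show "continuous_on {0..1} g" unfolding g_def
      by (intro continuous_intros continuous_on_h) auto
  qed simp
  then show ?thesis by (simp add: g_def)
qed

end

text \<open>The window radius is \<open>4 r\<close> because two displacements of size \<open>r\<close> (the critical point
  against \<open>\<alpha>\<close>, and the solution against the critical point) each change a difference of
  angles by at most \<open>2 r\<close>.\<close>

locale concave_window = interaction +
  fixes n :: nat and \<alpha> :: "nat \<Rightarrow> real" and r c :: real and \<kappa> :: "nat \<Rightarrow> nat \<Rightarrow> real"
  assumes r: "r > 0" and c: "c > 0" and n: "n > 0"
    and h2_le: "\<And>i j s. i < n \<Longrightarrow> j < n \<Longrightarrow> \<bar>s - (\<alpha> i - \<alpha> j)\<bar> \<le> 4 * r \<Longrightarrow> h2 s \<le> \<kappa> i j"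
    and coercive: "\<And>v. (\<Sum>i<n. \<Sum>j<n. \<kappa> i j * (v i - v j)\<^sup>2) \<le> - c * (\<Sum>i<n. \<Sum>j<n. (v i - v j)\<^sup>2)"
begin

text \<open>Both bounds sum the one-pair estimates and apply \<open>coercive\<close> once. The 1/2
  against double counting gives \<open>c / 2\<close>; the 1/2 of the Taylor remainder turns it into
  \<open>c / 4\<close> for the energy.\<close>

lemma
  assumes "\<And>i. i < n \<Longrightarrow> \<bar>\<theta> i - \<alpha> i\<bar> \<le> r" "\<And>i. i < n \<Longrightarrow> \<bar>v i\<bar> \<le> r"
  shows energy_add_le: "energy n (\<lambda>i. \<theta> i + v i) \<le> energy n \<theta> + slope n \<theta> v - c / 4 * (\<Sum>i<n. \<Sum>j<n. (v i - v j)\<^sup>2)"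
    and slope_add_le: "slope n (\<lambda>i. \<theta> i + v i) v \<le> slope n \<theta> v - c / 2 * (\<Sum>i<n. \<Sum>j<n. (v i - v j)\<^sup>2)"
proof -
  have win: "h2 s \<le> \<kappa> i j"
    if "i < n" "j < n" "min (\<theta> i - \<theta> j) (\<theta> i - \<theta> j + (v i - v j)) \<le> s"
      "s \<le> max (\<theta> i - \<theta> j) (\<theta> i - \<theta> j + (v i - v j))" for i j s
    using assms(1)[OF that(1)] assms(1)[OF that(2)] assms(2)[OF that(1)] assms(2)[OF that(2)] that
    by (intro h2_le) (auto simp: min_def max_def abs_le_iff split: if_splits)
  have "(\<Sum>i<n. \<Sum>j<n. h (\<theta> i - \<theta> j + (v i - v j)))
     \<le> (\<Sum>i<n. \<Sum>j<n. h (\<theta> i - \<theta> j) + h1 (\<theta> i - \<theta> j) * (v i - v j) + \<kappa> i j * (v i - v j)\<^sup>2 / 2)"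
    by (intro sum_mono h_increment_le win) auto
  also have "\<dots> = (\<Sum>i<n. \<Sum>j<n. h (\<theta> i - \<theta> j)) + (\<Sum>i<n. \<Sum>j<n. h1 (\<theta> i - \<theta> j) * (v i - v j))
      + (\<Sum>i<n. \<Sum>j<n. \<kappa> i j * (v i - v j)\<^sup>2) / 2"
    by (simp add: sum.distrib sum_divide_distrib)
  finally show "energy n (\<lambda>i. \<theta> i + v i) \<le> energy n \<theta> + slope n \<theta> v - c / 4 * (\<Sum>i<n. \<Sum>j<n. (v i - v j)\<^sup>2)"
    using coercive[of v] by (simp add: energy_def slope_def add_diff_add[symmetric] algebra_simps)
  have "(\<Sum>i<n. \<Sum>j<n. (h1 (\<theta> i - \<theta> j + (v i - v j)) - h1 (\<theta> i - \<theta> j)) * (v i - v j))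
     \<le> (\<Sum>i<n. \<Sum>j<n. \<kappa> i j * (v i - v j)\<^sup>2)"
    by (intro sum_mono h1_increment_le win) auto
  then have "2 * slope n (\<lambda>i. \<theta> i + v i) v - 2 * slope n \<theta> v \<le> (\<Sum>i<n. \<Sum>j<n. \<kappa> i j * (v i - v j)\<^sup>2)"
    by (simp add: slope_def left_diff_distrib sum_subtractf add_diff_add)
  then show "slope n (\<lambda>i. \<theta> i + v i) v \<le> slope n \<theta> v - c / 2 * (\<Sum>i<n. \<Sum>j<n. (v i - v j)\<^sup>2)"
    using coercive[of v] by simp
qed

lemma abs_le_of_sum_sq:
  fixes v :: "nat \<Rightarrow> real"
  assumes "(\<Sum>i<n. (v i)\<^sup>2) \<le> r\<^sup>2" "i < n"
  shows "\<bar>v i\<bar> \<le> r"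
proof -
  have "(v i)\<^sup>2 \<le> (\<Sum>i<n. (v i)\<^sup>2)" using assms by (intro member_le_sum) auto
  then have "(v i)\<^sup>2 \<le> r\<^sup>2" using assms by simp
  then show ?thesis using abs_le_square_iff[of "v i" r] r by simp
qed

text \<open>Maximise the energy over the mean-zero Euclidean ball of radius \<open>r\<close> around
  \<open>\<alpha>\<close>. On its sphere the linear term gains at most \<open>\<gamma> * r\<close>
  and concavity costs at least \<open>c * n * r\<^sup>2 / 2\<close>, which is more, so the maximum
  lies inside and is critical.\<close>

lemma critical_point_near:
  assumes grad: "(\<Sum>i<n. (force n i \<alpha>)\<^sup>2) \<le> \<gamma>\<^sup>2" and \<gamma>: "0 \<le> \<gamma>" "\<gamma> < c * n * r / 2"
  obtains \<theta> where "\<And>i. i < n \<Longrightarrow> \<bar>\<theta> i - \<alpha> i\<bar> \<le> r" "\<And>v. slope n \<theta> v = 0"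
proof -
  define K where "K = {v :: nat \<Rightarrow> real. (\<forall>i\<ge>n. v i = 0) \<and> (\<Sum>i<n. v i) = 0 \<and> (\<Sum>i<n. (v i)\<^sup>2) \<le> r\<^sup>2}"
  have "continuous_on K (\<lambda>v. energy n (\<lambda>i. \<alpha> i + v i))"
    unfolding energy_def
    by (intro continuous_intros continuous_on_h)
       (auto intro: continuous_on_subset[OF continuous_on_product_coordinates])
  moreover have "(\<lambda>_. 0) \<in> K" by (simp add: K_def)
  ultimately obtain v where v: "v \<in> K"
    and max: "\<And>w. w \<in> K \<Longrightarrow> energy n (\<lambda>i. \<alpha> i + w i) \<le> energy n (\<lambda>i. \<alpha> i + v i)"
    using continuous_attains_sup[OF compact_sum_zero_ball[of n r, folded K_def]] by blast
  have vr: "\<bar>v i\<bar> \<le> r" if "i < n" for i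
    using v that by (intro abs_le_of_sum_sq) (auto simp: K_def)
  define N where "N = sqrt (\<Sum>i<n. (v i)\<^sup>2)"
  have N: "N \<ge> 0" "N\<^sup>2 = (\<Sum>i<n. (v i)\<^sup>2)" by (simp_all add: N_def sum_nonneg)
  have Nr: "N \<noteq> r"
  proof
    assume Nr: "N = r"
    have "energy n (\<lambda>i. \<alpha> i + v i) \<le> energy n \<alpha> + slope n \<alpha> v - c / 4 * (2 * real n * N\<^sup>2)"
      using energy_add_le[of \<alpha> v] vr r sum_sq_diff_of_sum_zero[of v n] v N(2) by (simp add: K_def)
    moreover have "energy n \<alpha> \<le> energy n (\<lambda>i. \<alpha> i + v i)"
      using max[OF \<open>(\<lambda>_. 0) \<in> K\<close>] by simp
    moreover have "slope n \<alpha> v \<le> N * \<gamma>"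
    proof (rule power2_le_imp_le)
      have "(slope n \<alpha> v)\<^sup>2 \<le> (\<Sum>i<n. (v i)\<^sup>2) * (\<Sum>i<n. (force n i \<alpha>)\<^sup>2)"
        unfolding slope_eq_force by (rule Cauchy_Schwarz_ineq_sum)
      also have "\<dots> \<le> (\<Sum>i<n. (v i)\<^sup>2) * \<gamma>\<^sup>2"
        by (intro mult_left_mono grad sum_nonneg) auto
      finally show "(slope n \<alpha> v)\<^sup>2 \<le> (N * \<gamma>)\<^sup>2" by (simp add: power_mult_distrib N(2))
    qed (use N \<gamma> in simp)
    ultimately have "N * (c * n * r / 2) \<le> N * \<gamma>"
      by (simp add: Nr power2_eq_square mult.assoc mult.left_commute mult.commute)
    then show False using \<gamma> r by (simp add: Nr)
  qed
  have Nlt: "(\<Sum>i<n. (v i)\<^sup>2) < r\<^sup>2"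
  proof -
    have "N\<^sup>2 \<le> r\<^sup>2" using v N(2) by (simp add: K_def)
    then have "N \<le> r" by (rule power2_le_imp_le[OF _ less_imp_le[OF r]])
    then have "N < r" using Nr by simp
    then show ?thesis using N power_strict_mono[of N r 2] by simp
  qed
  have zero: "slope n (\<lambda>i. \<alpha> i + v i) w = 0" if w: "(\<Sum>i<n. w i) = 0" for w
  proof -
    \<comment> \<open>The indices from \<open>n\<close> on are not moved, because members of
      \<open>K\<close> vanish there.\<close>
    define E where "E s = energy n (\<lambda>i. \<alpha> i + (v i + s * (if i < n then w i else 0)))" for s
    have "(E has_real_derivative slope n (\<lambda>i. \<alpha> i + v i) w) (at 0)"
    proof -
      have "((\<lambda>s. (1/2) * (\<Sum>i<n. \<Sum>j<n. h ((\<alpha> i + (v i + s * w i)) - (\<alpha> j + (v j + s * w j)))))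
        has_real_derivative (1/2) * (\<Sum>i<n. \<Sum>j<n. h1 ((\<alpha> i + (v i + 0 * w i)) - (\<alpha> j + (v j + 0 * w j))) * (w i - w j))) (at 0)"
        by (intro DERIV_cmult DERIV_sum DERIV_chain'[OF _ dh]) (auto intro!: derivative_eq_intros)
      then show ?thesis by (simp add: E_def[abs_def] energy_def slope_def)
    qed
    moreover have "eventually (\<lambda>s. (\<Sum>i<n. (v i + s * w i)\<^sup>2) < r\<^sup>2) (nhds 0)"
    proof -
      have "((\<lambda>s. (\<Sum>i<n. (v i + s * w i)\<^sup>2)) \<longlongrightarrow> (\<Sum>i<n. (v i + 0 * w i)\<^sup>2)) (nhds 0)"
        by (intro tendsto_intros filterlim_ident)
      then show ?thesis using Nlt by (intro order_tendstoD(2)) auto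
    qed
    then obtain d where d: "d > 0" "\<And>s. dist s 0 < d \<Longrightarrow> (\<Sum>i<n. (v i + s * w i)\<^sup>2) < r\<^sup>2"
      by (auto simp: eventually_nhds_metric)
    have "\<forall>s. \<bar>0 - s\<bar> < d \<longrightarrow> E s \<le> E 0"
    proof (intro allI impI)
      fix s :: real assume "\<bar>0 - s\<bar> < d"
      then have "(\<Sum>i<n. (v i + s * w i)\<^sup>2) < r\<^sup>2" using d(2)[of s] by simp
      moreover have "(\<Sum>i<n. v i + s * w i) = 0"
        using v w by (simp add: K_def sum.distrib flip: sum_distrib_left)
      ultimately have "(\<lambda>i. v i + s * (if i < n then w i else 0)) \<in> K"
        using v by (auto simp: K_def)
      then show "E s \<le> E 0" using max by (simp add: E_def)
    qed
    ultimately show ?thesis using d(1) by (intro DERIV_local_max)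
  qed
  show thesis
  proof (rule that[of "\<lambda>i. \<alpha> i + v i"])
    fix w :: "nat \<Rightarrow> real"
    \<comment> \<open>Subtracting the mean does not change \<open>slope\<close>, so mean-zero
      directions suffice.\<close>
    define m where "m = (\<Sum>i<n. w i) / n"
    have "slope n (\<lambda>i. \<alpha> i + v i) (\<lambda>i. w i - m) = 0"
      using n by (intro zero) (simp add: sum_subtractf m_def)
    then show "slope n (\<lambda>i. \<alpha> i + v i) w = 0" by (simp add: slope_def)
  qed (use vr in simp)
qed

lemma energy_local_max:
  assumes "\<And>i. i < n \<Longrightarrow> \<bar>\<theta> i - \<alpha> i\<bar> \<le> r" "\<And>v. slope n \<theta> v = 0" "\<And>i. i < n \<Longrightarrow> \<bar>v i\<bar> \<le> r"
  shows "energy n (\<lambda>i. \<theta> i + v i) \<le> energy n \<theta>"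
proof -
  have "energy n (\<lambda>i. \<theta> i + v i) \<le> energy n \<theta> + 0 - c / 4 * (\<Sum>i<n. \<Sum>j<n. (v i - v j)\<^sup>2)"
    using energy_add_le[of \<theta> v] assms by simp
  moreover have "0 \<le> (\<Sum>i<n. \<Sum>j<n. (v i - v j)\<^sup>2)" by (intro sum_nonneg) auto
  ultimately show ?thesis using c by (smt (verit) mult_nonneg_nonneg divide_pos_pos)
qed

text \<open>The sum of the angles is conserved, so the only candidate for the limit is the rotation
  of \<open>\<theta>s\<close> by the mean \<open>m\<close> of the initial displacement. The squared
  distance \<open>W\<close> to it decays at rate \<open>2 * c * n\<close> as long as it is below
  \<open>r\<^sup>2\<close>.\<close>

lemma flow_converges:
  assumes \<theta>s: "\<And>i. i < n \<Longrightarrow> \<bar>\<theta>s i - \<alpha> i\<bar> \<le> r" and crit: "\<And>v. slope n \<theta>s v = 0"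
    and sol: "\<And>i t. i < n \<Longrightarrow> t \<ge> 0 \<Longrightarrow> ((\<lambda>s. \<theta> s i) has_real_derivative force n i (\<theta> t)) (at t within {0..})"
    and init: "\<And>i. i < n \<Longrightarrow> \<bar>\<theta> 0 i - \<theta>s i\<bar> \<le> r / (2 * (real n + 1))"
  obtains m where "\<And>i. i < n \<Longrightarrow> ((\<lambda>t. \<theta> t i) \<longlongrightarrow> \<theta>s i + m) at_top"
proof -
  \<comment> \<open>Since \<open>m\<close> is a mean of displacements, each \<open>w 0 i\<close> is
    at most \<open>2 * \<delta>\<close> in absolute value. So \<open>W 0\<close> is at most
    \<open>n * (2 * \<delta>)\<^sup>2\<close>, below
    \<open>((n + 1) * (2 * \<delta>))\<^sup>2 = r\<^sup>2\<close>.\<close>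
  define \<delta> where "\<delta> = r / (2 * (real n + 1))"
  define m where "m = (\<Sum>i<n. \<theta> 0 i - \<theta>s i) / n"
  define w where "w t i = \<theta> t i - (\<theta>s i + m)" for t i
  define W where "W t = (\<Sum>i<n. (w t i)\<^sup>2)" for t
  have sum0: "(\<Sum>i<n. w t i) = 0" if "t \<ge> 0" for t
  proof -
    have d: "((\<lambda>s. \<Sum>i<n. \<theta> s i) has_real_derivative 0) (at t within {0..})" if "t \<in> {0..}" for t
      using DERIV_sum[of "{..<n}" "\<lambda>s i. \<theta> s i" "\<lambda>i. force n i (\<theta> t)" "at t within {0..}"] sol[of _ t] that
      by (simp add: sum_force)
    obtain k where k: "\<And>t. t \<in> {0..} \<Longrightarrow> (\<Sum>i<n. \<theta> t i) = k"
      using has_field_derivative_zero_constant[OF convex_real_interval(1) d] by blast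
    have "(\<Sum>i<n. w t i) = (\<Sum>i<n. \<theta> t i) - (\<Sum>i<n. \<theta> 0 i)"
      using n by (simp add: w_def sum_subtractf sum.distrib m_def)
    then show ?thesis using k[of t] k[of 0] that by simp
  qed
  have dW: "(W has_real_derivative 2 * slope n (\<theta> t) (w t)) (at t within {0..})" if "t \<ge> 0" for t
  proof -
    have "((\<lambda>t. \<Sum>i<n. (w t i)\<^sup>2) has_real_derivative (\<Sum>i<n. 2 * (w t i * force n i (\<theta> t)))) (at t within {0..})"
    proof (rule DERIV_sum)
      fix i assume "i \<in> {..<n}"
      then have "((\<lambda>t. w t i) has_real_derivative force n i (\<theta> t)) (at t within {0..})"
        unfolding w_def using sol[of i t] that by (auto intro!: derivative_eq_intros)
      then show "((\<lambda>t. (w t i)\<^sup>2) has_real_derivative 2 * (w t i * force n i (\<theta> t))) (at t within {0..})"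
        by (auto intro!: derivative_eq_intros)
    qed
    then show ?thesis by (simp add: W_def[abs_def] slope_eq_force sum_distrib_left)
  qed
  have le: "2 * slope n (\<theta> t) (w t) \<le> - (2 * c * n) * W t" if "t \<ge> 0" "W t < r\<^sup>2" for t
  proof -
    \<comment> \<open>The point \<open>\<theta>s i + w t i\<close> is
      \<open>\<theta> t i - m\<close>. It stays in the window even when the rotation
      \<open>m\<close> would leave it, and \<open>slope\<close> does not see
      \<open>m\<close>.\<close>
    have "slope n (\<lambda>i. \<theta>s i + w t i) (w t) \<le> slope n \<theta>s (w t) - c / 2 * (\<Sum>i<n. \<Sum>j<n. (w t i - w t j)\<^sup>2)"
      using that by (intro slope_add_le \<theta>s abs_le_of_sum_sq) (auto simp: W_def)
    also have "\<dots> = - (c * n) * W t"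
      using sum_sq_diff_of_sum_zero[OF sum0[OF that(1)]] crit by (simp add: W_def)
    also have "slope n (\<lambda>i. \<theta>s i + w t i) (w t) = slope n (\<theta> t) (w t)"
      by (simp add: slope_def w_def)
    finally show ?thesis by simp
  qed
  have W0: "W 0 < r\<^sup>2"
  proof -
    have \<delta>: "\<delta> > 0" using r by (simp add: \<delta>_def)
    have "\<bar>\<Sum>i<n. \<theta> 0 i - \<theta>s i\<bar> \<le> (\<Sum>i<n. \<bar>\<theta> 0 i - \<theta>s i\<bar>)" by (rule sum_abs)
    also have "\<dots> \<le> (\<Sum>i<n. \<delta>)" using init by (intro sum_mono) (auto simp: \<delta>_def)
    finally have "\<bar>m\<bar> \<le> \<delta>" using n by (simp add: m_def field_simps)
    then have "\<bar>w 0 i\<bar> \<le> 2 * \<delta>" if "i < n" for i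
      using init[OF that, folded \<delta>_def] by (simp add: w_def abs_le_iff)
    then have "(w 0 i)\<^sup>2 \<le> (2 * \<delta>)\<^sup>2" if "i < n" for i
      using that \<delta> abs_le_square_iff[of "w 0 i" "2 * \<delta>"] by (auto simp del: power_mult_distrib)
    then have "W 0 \<le> (\<Sum>i<n. (2 * \<delta>)\<^sup>2)"
      unfolding W_def by (intro sum_mono) blast
    also have "\<dots> = n * (2 * \<delta>)\<^sup>2" by simp
    also have "\<dots> < (real n + 1)\<^sup>2 * (2 * \<delta>)\<^sup>2"
    proof (rule mult_strict_right_mono)
      show "real n < (real n + 1)\<^sup>2"
        using zero_le_square[of "real n"] unfolding power2_eq_square distrib_left distrib_right by linarith
      show "0 < (2 * \<delta>)\<^sup>2" using \<delta> by simp
    qed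
    also have "\<dots> = ((real n + 1) * (2 * \<delta>))\<^sup>2" by (rule power_mult_distrib[symmetric])
    also have "(real n + 1) * (2 * \<delta>) = r" unfolding \<delta>_def by (simp add: divide_simps)
    finally show ?thesis .
  qed
  have bound: "W t \<le> W 0 * exp (- (2 * c * n) * t)" if "t \<ge> 0" for t
    using c that by (intro exp_decay_below_barrier[OF dW le _ W0]) (auto simp: W_def sum_nonneg)
  have "((\<lambda>t. W 0 * exp (- (2 * c * n) * t)) \<longlongrightarrow> 0) at_top"
  proof -
    have "filterlim (\<lambda>t. - (2 * c * n) * t) at_bot at_top"
      using c n by (intro filterlim_tendsto_neg_mult_at_bot[OF tendsto_const]) (auto intro: filterlim_ident)
    then have "((\<lambda>t. exp (- (2 * c * n) * t)) \<longlongrightarrow> 0) at_top"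
      by (rule filterlim_compose[OF exp_at_bot])
    then show ?thesis using tendsto_mult_right_zero by blast
  qed
  then have Wlim: "(W \<longlongrightarrow> 0) at_top"
  proof (rule tendsto_sandwich[OF _ _ tendsto_const, rotated 2])
    show "\<forall>\<^sub>F t in at_top. 0 \<le> W t" by (simp add: W_def sum_nonneg)
    show "\<forall>\<^sub>F t in at_top. W t \<le> W 0 * exp (- (2 * c * n) * t)"
      using eventually_ge_at_top[of 0] by (rule eventually_mono) (rule bound)
  qed
  show thesis
  proof (rule that[of m])
    fix i assume i: "i < n"
    have "((\<lambda>t. (w t i)\<^sup>2) \<longlongrightarrow> 0) at_top"
    proof (rule tendsto_sandwich[OF _ _ tendsto_const Wlim])
      have "(w t i)\<^sup>2 \<le> W t" for t
        unfolding W_def using i by (intro member_le_sum) auto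
      then show "\<forall>\<^sub>F t in at_top. (w t i)\<^sup>2 \<le> W t" by simp
    qed simp
    then have "((\<lambda>t. sqrt ((w t i)\<^sup>2)) \<longlongrightarrow> sqrt 0) at_top" by (rule tendsto_real_sqrt)
    then have "((\<lambda>t. w t i) \<longlongrightarrow> 0) at_top" by (simp add: tendsto_rabs_zero_iff)
    then have "((\<lambda>t. w t i + (\<theta>s i + m)) \<longlongrightarrow> 0 + (\<theta>s i + m)) at_top"
      by (intro tendsto_intros)
    then show "((\<lambda>t. \<theta> t i) \<longlongrightarrow> \<theta>s i + m) at_top" by (simp add: w_def)
  qed
qed

end

section \<open>From angles to the torus\<close>

lemma inner_real2: "(x :: real^2) \<bullet> y = x $ 1 * y $ 1 + x $ 2 * y $ 2"
  by (simp add: inner_vec_def sum_2)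

lemma vec2_eqI: "x $ 1 = y $ 1 \<Longrightarrow> x $ 2 = y $ 2 \<Longrightarrow> x = (y :: real^2)"
  by (simp add: vec_eq_iff forall_2)

lemma circ_nth [simp]: "circ t $ 1 = cos t" "circ t $ 2 = sin t"
  by (simp_all add: circ_def)

lemma inner_circ: "circ a \<bullet> circ b = cos (a - b)"
  by (simp add: inner_real2 cos_diff)

lemma norm_circ [simp]: "norm (circ t) = 1"
  by (simp add: norm_eq_1 inner_circ)

text \<open>The vector \<open>circ (a + pi / 2)\<close> is the unit tangent at
  \<open>circ a\<close>; velocities and gradients below are multiples of it.\<close>

lemma circ_add: "circ (a + v) = cos v *\<^sub>R circ a + sin v *\<^sub>R circ (a + pi / 2)"
  by (rule vec2_eqI) (simp_all add: cos_add sin_add algebra_simps)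

lemma circ_minus_proj: "circ b - cos (a - b) *\<^sub>R circ a = sin (b - a) *\<^sub>R circ (a + pi / 2)"
  using circ_add[of a "b - a"] by (simp add: cos_diff mult.commute)

lemma has_vector_derivative_circ:
  assumes "(f has_real_derivative f') (at t within S)"
  shows "((\<lambda>t. circ (f t)) has_vector_derivative f' *\<^sub>R circ (f t + pi / 2)) (at t within S)"
proof -
  have "((\<lambda>t. cos (f t) *\<^sub>R (axis 1 1 :: real^2) + sin (f t) *\<^sub>R axis 2 1) has_vector_derivative
      (- sin (f t) * f') *\<^sub>R axis 1 1 + (cos (f t) * f') *\<^sub>R axis 2 1) (at t within S)"
    using assms by (auto intro!: derivative_eq_intros simp: algebra_simps)
  moreover have "(\<lambda>t. cos (f t) *\<^sub>R (axis 1 1 :: real^2) + sin (f t) *\<^sub>R axis 2 1) = (\<lambda>t. circ (f t))"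
    by (intro ext vec2_eqI) (simp_all add: axis_def)
  moreover have "(- sin (f t) * f') *\<^sub>R (axis 1 1 :: real^2) + (cos (f t) * f') *\<^sub>R axis 2 1 = f' *\<^sub>R circ (f t + pi / 2)"
    by (intro vec2_eqI) (simp_all add: axis_def cos_add sin_add)
  ultimately show ?thesis by simp
qed

lemma continuous_on_circ: "continuous_on S circ"
  unfolding continuous_on_eq_continuous_within
  using has_vector_derivative_continuous[OF has_vector_derivative_circ[OF DERIV_ident]] by simp

lemma tendsto_circ: "(f \<longlongrightarrow> a) F \<Longrightarrow> ((\<lambda>t. circ (f t)) \<longlongrightarrow> circ a) F"
  using continuous_on_tendsto_compose[OF continuous_on_circ[of UNIV]] by auto

text \<open>In the orthonormal frame of normal and tangent at \<open>circ a\<close>, the tangential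
  coordinate of \<open>y\<close> is below \<open>sin \<rho>\<close> in absolute value, and a
  distance below 1 makes the normal one positive. Hence \<open>arcsin\<close> of the former is the
  angle from \<open>circ a\<close> to \<open>y\<close>.\<close>

lemma circ_near:
  assumes y: "norm y = 1" and \<rho>: "0 < \<rho>" "\<rho> < pi / 2" and near: "norm (y - circ a) < sin \<rho>"
  obtains v where "\<bar>v\<bar> \<le> \<rho>" "y = circ (a + v)"
proof -
  define c where "c = y \<bullet> circ a"
  define s where "s = y \<bullet> circ (a + pi / 2)"
  have yy: "y $ 1 * y $ 1 + y $ 2 * y $ 2 = 1" using y by (simp add: norm_eq_1 inner_real2)
  have aa: "cos a * cos a + sin a * sin a = 1"
    using sin_cos_squared_add3[of a] by simp
  have yeq: "y = c *\<^sub>R circ a + s *\<^sub>R circ (a + pi / 2)"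
  proof (rule vec2_eqI)
    have "c * cos a - s * sin a = y $ 1 * (cos a * cos a + sin a * sin a)"
      by (simp add: c_def s_def inner_real2 cos_add sin_add algebra_simps
          del: sin_cos_squared_add3)
    also have "\<dots> = y $ 1" unfolding aa by simp
    finally show "y $ 1 = (c *\<^sub>R circ a + s *\<^sub>R circ (a + pi / 2)) $ 1"
      by (simp add: cos_add sin_add)
    have "c * sin a + s * cos a = y $ 2 * (cos a * cos a + sin a * sin a)"
      by (simp add: c_def s_def inner_real2 cos_add sin_add algebra_simps
          del: sin_cos_squared_add3)
    also have "\<dots> = y $ 2" unfolding aa by simp
    finally show "y $ 2 = (c *\<^sub>R circ a + s *\<^sub>R circ (a + pi / 2)) $ 2"
      by (simp add: cos_add sin_add)
  qed
  have "c\<^sup>2 + s\<^sup>2 = (y $ 1 * y $ 1 + y $ 2 * y $ 2) * (cos a * cos a + sin a * sin a)"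
    by (simp add: c_def s_def inner_real2 cos_add sin_add power2_eq_square algebra_simps
        del: sin_cos_squared_add3)
  then have cs: "c\<^sup>2 + s\<^sup>2 = 1" using aa yy by simp
  have n2: "(norm (y - circ a))\<^sup>2 = 2 - 2 * c"
    using y by (simp add: power2_norm_eq_inner inner_diff inner_commute c_def norm_eq_1 inner_circ)
  have sr: "sin \<rho> > 0" using \<rho> by (intro sin_gt_zero) auto
  have "(norm (y - circ a))\<^sup>2 < 1"
    using less_le_trans[OF near sin_le_one] by (simp add: abs_square_less_1)
  then have c0: "c > 0" using n2 by simp
  have "s = (y - circ a) \<bullet> circ (a + pi / 2)"
    by (simp add: s_def inner_diff inner_circ)
  then have "\<bar>s\<bar> \<le> norm (y - circ a) * norm (circ (a + pi / 2))"
    by (metis Cauchy_Schwarz_ineq2)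
  then have s: "\<bar>s\<bar> < sin \<rho>" using near by simp
  then have s1: "- 1 \<le> s" "s \<le> 1" using sin_le_one[of \<rho>] by linarith+
  have "cos (arcsin s) = c"
    using c0 cs s1 by (simp add: cos_arcsin) (smt (verit) real_sqrt_abs)
  then have "y = circ (a + arcsin s)"
    using yeq s1 by (subst circ_add) simp
  moreover have "\<bar>arcsin s\<bar> \<le> \<rho>"
  proof -
    have "arcsin s \<le> arcsin (sin \<rho>)" "arcsin (- sin \<rho>) \<le> arcsin s"
      using s s1 sin_le_one[of \<rho>] by (auto intro!: arcsin_le_arcsin)
    then show ?thesis using \<rho> sr sin_le_one[of \<rho>] by (simp add: arcsin_sin arcsin_minus)
  qed
  ultimately show thesis by (rule that[rotated])
qed

section \<open>The gradient flow of a kernel objective on the torus\<close>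

locale radial_kernel =
  fixes \<phi> \<phi>1 \<phi>2 :: "real \<Rightarrow> real" and L :: real
  assumes d\<phi>: "\<And>t. (\<phi> has_real_derivative \<phi>1 t) (at t)"
    and d\<phi>1: "\<And>t. (\<phi>1 has_real_derivative \<phi>2 t) (at t)"
    and \<phi>1_le: "\<And>t. \<bar>\<phi>1 t\<bar> \<le> 1"
    and \<phi>2_le: "\<And>t. \<bar>\<phi>2 t\<bar> \<le> L"
begin

lemma L_nonneg: "L \<ge> 0"
  using \<phi>2_le[of 0] by linarith

lemma abs_diff_le_of_deriv:
  fixes f f' :: "real \<Rightarrow> real"
  assumes "\<And>x. (f has_real_derivative f' x) (at x)" "\<And>x. \<bar>f' x\<bar> \<le> B"
  shows "\<bar>f x - f y\<bar> \<le> B * \<bar>x - y\<bar>"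
  using field_differentiable_bound[of UNIV f f' B x y] assms
  by simp

text \<open>Each column enters the double sum both as row and as column index, which absorbs the
  factor 1/2. The diagonal term is radial, so on the torus it disappears from the Riemannian
  gradient.\<close>

lemma egrad_obj:
  assumes i: "i < n"
  shows "egrad (obj \<phi> n) X i = (\<Sum>j<n. \<phi>1 (X i \<bullet> X j) *\<^sub>R X j)" (is "_ = ?D")
proof -
  define e where "e a w = (if a = i then w else 0)" for a and w :: "real^2"
  have upd: "((\<lambda>v. (X(i := v)) a) has_derivative e a) (at (X i))" for a
    by (cases "a = i") (auto simp: e_def[abs_def])
  have "((\<lambda>v. obj \<phi> n (X(i := v))) has_derivative
      (\<lambda>w. (1/2) * (\<Sum>a<n. \<Sum>b<n. (X a \<bullet> e b w + e a w \<bullet> X b) * \<phi>1 (X a \<bullet> X b)))) (at (X i))"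
    unfolding obj_def
  proof (intro has_derivative_mult_right has_derivative_sum)
    fix a b
    have "((\<lambda>v. (X(i := v)) a \<bullet> (X(i := v)) b) has_derivative
       (\<lambda>w. (X(i := X i)) a \<bullet> e b w + e a w \<bullet> (X(i := X i)) b)) (at (X i))"
      by (rule has_derivative_inner[OF upd upd])
    then show "((\<lambda>v. \<phi> ((X(i := v)) a \<bullet> (X(i := v)) b)) has_derivative
       (\<lambda>w. (X a \<bullet> e b w + e a w \<bullet> X b) * \<phi>1 (X a \<bullet> X b))) (at (X i))"
      using DERIV_compose_FDERIV[OF d\<phi>] by fastforce
  qed
  moreover have "(1/2) * (\<Sum>a<n. \<Sum>b<n. (X a \<bullet> e b w + e a w \<bullet> X b) * \<phi>1 (X a \<bullet> X b)) = w \<bullet> ?D" for w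
  proof -
    have 1: "(\<Sum>a<n. \<Sum>b<n. (e a w \<bullet> X b) * \<phi>1 (X a \<bullet> X b)) = w \<bullet> ?D"
    proof -
      have "(\<Sum>a<n. \<Sum>b<n. (e a w \<bullet> X b) * \<phi>1 (X a \<bullet> X b))
        = (\<Sum>a<n. if a = i then \<Sum>b<n. (w \<bullet> X b) * \<phi>1 (X i \<bullet> X b) else 0)"
        by (intro sum.cong refl) (auto simp: e_def)
      also have "\<dots> = w \<bullet> ?D" using i by (simp add: inner_sum_right mult.commute)
      finally show ?thesis .
    qed
    have "(\<Sum>a<n. \<Sum>b<n. (X a \<bullet> e b w) * \<phi>1 (X a \<bullet> X b)) = (\<Sum>a<n. \<Sum>b<n. (e a w \<bullet> X b) * \<phi>1 (X a \<bullet> X b))"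
      by (subst sum.swap) (simp add: inner_commute)
    then show ?thesis using 1 by (simp add: distrib_right sum.distrib)
  qed
  ultimately have "GDERIV (\<lambda>v. obj \<phi> n (X(i := v))) (X i) :> ?D"
    by (simp add: gderiv_def)
  moreover have "D = ?D" if "GDERIV (\<lambda>v. obj \<phi> n (X(i := v))) (X i) :> D" for D
  proof -
    have "(\<lambda>h. h \<bullet> D) = (\<lambda>h. h \<bullet> ?D)"
      using that calculation unfolding gderiv_def by (rule has_derivative_unique)
    then show ?thesis by (metis vector_eq_ldot)
  qed
  ultimately show ?thesis unfolding egrad_def by (intro the_equality)
qed

definition pull :: "real^2 \<Rightarrow> real^2 \<Rightarrow> real^2" where
  "pull x y = \<phi>1 (x \<bullet> y) *\<^sub>R (y - (x \<bullet> y) *\<^sub>R x)"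

lemma rgrad_obj: "i < n \<Longrightarrow> rgrad (obj \<phi> n) X i = (\<Sum>j<n. pull (X i) (X j))"
  by (simp add: rgrad_def egrad_obj pull_def inner_sum_right scaleR_sum_left sum_subtractf
      scaleR_right_diff_distrib)

text \<open>Unit vectors suffice because solutions stay on the torus. The part \<open>2 * L\<close>
  is the variation of \<open>\<phi>1\<close> times a projected vector of norm at most 2; the part 2
  is the variation of that vector.\<close>

lemma pull_lipschitz:
  assumes "norm x = 1" "norm y = 1" "norm x' = 1" "norm y' = 1"
  shows "norm (pull x y - pull x' y') \<le> (2 * L + 2) * (norm (x - x') + norm (y - y'))"
proof -
  define e where "e = norm (x - x') + norm (y - y')"
  have e: "e \<ge> 0" by (simp add: e_def)
  have "x \<bullet> y - x' \<bullet> y' = (x - x') \<bullet> y + x' \<bullet> (y - y')" by (simp add: inner_diff)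
  also have "\<bar>\<dots>\<bar> \<le> norm (x - x') * norm y + norm x' * norm (y - y')"
    by (intro order_trans[OF abs_triangle_ineq] add_mono Cauchy_Schwarz_ineq2)
  finally have a: "\<bar>x \<bullet> y - x' \<bullet> y'\<bar> \<le> e" using assms by (simp add: e_def)
  have b: "\<bar>x \<bullet> y\<bar> \<le> 1" "\<bar>x' \<bullet> y'\<bar> \<le> 1"
    using Cauchy_Schwarz_ineq2[of x y] Cauchy_Schwarz_ineq2[of x' y'] assms by auto
  define w where "w = y - (x \<bullet> y) *\<^sub>R x"
  define w' where "w' = y' - (x' \<bullet> y') *\<^sub>R x'"
  have nw: "norm w \<le> 2"
    using norm_triangle_ineq4[of y "(x \<bullet> y) *\<^sub>R x"] assms b by (simp add: w_def)
  have "w - w' = (y - y') - ((x \<bullet> y - x' \<bullet> y') *\<^sub>R x + (x' \<bullet> y') *\<^sub>R (x - x'))"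
    by (simp add: w_def w'_def algebra_simps)
  also have "norm \<dots> \<le> norm (y - y') + (\<bar>x \<bullet> y - x' \<bullet> y'\<bar> * norm x + \<bar>x' \<bullet> y'\<bar> * norm (x - x'))"
    by (intro order_trans[OF norm_triangle_ineq4] add_mono order_refl order_trans[OF norm_triangle_ineq]) simp_all
  also have "\<dots> \<le> norm (y - y') + (e * 1 + 1 * norm (x - x'))"
    using a b assms by (intro add_mono mult_mono) auto
  finally have ww: "norm (w - w') \<le> 2 * e" by (simp add: e_def)
  have f: "\<bar>\<phi>1 (x \<bullet> y) - \<phi>1 (x' \<bullet> y')\<bar> \<le> L * e"
    using abs_diff_le_of_deriv[OF d\<phi>1 \<phi>2_le, of "x \<bullet> y" "x' \<bullet> y'"] a L_nonneg
    by (meson mult_left_mono order_trans)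
  have "pull x y - pull x' y' = (\<phi>1 (x \<bullet> y) - \<phi>1 (x' \<bullet> y')) *\<^sub>R w + \<phi>1 (x' \<bullet> y') *\<^sub>R (w - w')"
    by (simp add: pull_def w_def[symmetric] w'_def[symmetric] algebra_simps)
  also have "norm \<dots> \<le> \<bar>\<phi>1 (x \<bullet> y) - \<phi>1 (x' \<bullet> y')\<bar> * norm w + \<bar>\<phi>1 (x' \<bullet> y')\<bar> * norm (w - w')"
    by (rule order_trans[OF norm_triangle_ineq]) simp
  also have "\<dots> \<le> (L * e) * 2 + 1 * (2 * e)"
    using f nw ww \<phi>1_le e L_nonneg by (intro add_mono mult_mono) auto
  finally show ?thesis by (simp add: e_def algebra_simps)
qed

text \<open>Works on vectors, since an arbitrary solution comes without a choice of angles: Gronwall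
  for the squared distance \<open>U\<close>, which starts at 0.\<close>

lemma grad_flow_unique:
  assumes X: "grad_flow_sol n (obj \<phi> n) X0 X" and Y: "grad_flow_sol n (obj \<phi> n) X0 Y"
    and t: "t \<ge> 0" and i: "i < n"
  shows "X t i = Y t i"
proof -
  define U where "U t = (\<Sum>i<n. (X t i - Y t i) \<bullet> (X t i - Y t i))" for t
  define V where "V t i = (\<Sum>j<n. pull (X t i) (X t j) - pull (Y t i) (Y t j))" for t i
  define C where "C = 2 * L + 2"
  have C: "C \<ge> 0" using L_nonneg by (simp add: C_def)
  have dU: "(U has_real_derivative (\<Sum>i<n. 2 * ((X t i - Y t i) \<bullet> V t i))) (at t within {0..})" if "t \<ge> 0" for t
    unfolding U_def
  proof (rule DERIV_sum)
    fix i assume "i \<in> {..<n}"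
    then have "((\<lambda>s. X s i) has_vector_derivative (\<Sum>j<n. pull (X t i) (X t j))) (at t within {0..})"
      "((\<lambda>s. Y s i) has_vector_derivative (\<Sum>j<n. pull (Y t i) (Y t j))) (at t within {0..})"
      using X Y that by (auto simp: grad_flow_sol_def simp flip: rgrad_obj)
    then have "((\<lambda>s. X s i - Y s i) has_vector_derivative V t i) (at t within {0..})"
      unfolding V_def sum_subtractf by (rule has_vector_derivative_diff)
    then have "((\<lambda>s. (X s i - Y s i) \<bullet> (X s i - Y s i)) has_derivative
       (\<lambda>h. (X t i - Y t i) \<bullet> (h *\<^sub>R V t i) + (h *\<^sub>R V t i) \<bullet> (X t i - Y t i))) (at t within {0..})"
      unfolding has_vector_derivative_def by (intro has_derivative_inner)
    then show "((\<lambda>s. (X s i - Y s i) \<bullet> (X s i - Y s i)) has_real_derivative 2 * ((X t i - Y t i) \<bullet> V t i)) (at t within {0..})"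
      unfolding has_field_derivative_def
      by (rule has_derivative_eq_rhs) (simp add: fun_eq_iff inner_commute)
  qed
  \<comment> \<open>The 6 is the factor 2 of the differentiated square times 3, from bounding
    \<open>d i * (d i + d j)\<close> by \<open>2 * (d i)\<^sup>2 + (d j)\<^sup>2\<close> and summing
    over both indices.\<close>
  have le: "(\<Sum>i<n. 2 * ((X t i - Y t i) \<bullet> V t i)) \<le> 6 * C * n * U t" if "t \<ge> 0" for t
  proof -
    define d where "d i = norm (X t i - Y t i)" for i
    have nrm: "norm (X t i) = 1" "norm (Y t i) = 1" if "i < n" for i
      using X Y that \<open>t \<ge> 0\<close> by (auto simp: grad_flow_sol_def torus_def)
    have "(X t i - Y t i) \<bullet> V t i \<le> (\<Sum>j<n. C * (2 * (d i)\<^sup>2 + (d j)\<^sup>2))" if "i < n" for i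
    proof -
      have "norm (V t i) \<le> (\<Sum>j<n. C * (d i + d j))"
        unfolding V_def C_def d_def using that nrm by (intro sum_norm_le pull_lipschitz) auto
      then have "d i * norm (V t i) \<le> d i * (\<Sum>j<n. C * (d i + d j))"
        by (intro mult_left_mono) (auto simp: d_def)
      moreover have "(X t i - Y t i) \<bullet> V t i \<le> d i * norm (V t i)"
        unfolding d_def by (rule norm_cauchy_schwarz)
      moreover have "d i * (\<Sum>j<n. C * (d i + d j)) \<le> (\<Sum>j<n. C * (2 * (d i)\<^sup>2 + (d j)\<^sup>2))"
        unfolding sum_distrib_left
      proof (rule sum_mono)
        fix j
        have "d i * (d i + d j) = (d i)\<^sup>2 + d i * d j" by (simp add: power2_eq_square distrib_left)
        then have "d i * (d i + d j) \<le> 2 * (d i)\<^sup>2 + (d j)\<^sup>2"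
          using sum_squares_bound[of "d i" "d j"] zero_le_power2[of "d i"] zero_le_power2[of "d j"] by linarith
        then show "d i * (C * (d i + d j)) \<le> C * (2 * (d i)\<^sup>2 + (d j)\<^sup>2)"
          using C by (metis mult.left_commute mult_left_mono)
      qed
      ultimately show ?thesis by linarith
    qed
    then have "(\<Sum>i<n. 2 * ((X t i - Y t i) \<bullet> V t i)) \<le> (\<Sum>i<n. 2 * (\<Sum>j<n. C * (2 * (d i)\<^sup>2 + (d j)\<^sup>2)))"
      by (intro sum_mono mult_left_mono) auto
    also have "\<dots> = 2 * C * (2 * (n * (\<Sum>i<n. (d i)\<^sup>2)) + n * (\<Sum>i<n. (d i)\<^sup>2))"
      by (simp add: sum.distrib distrib_left sum_distrib_left[symmetric])
    also have "(\<Sum>i<n. (d i)\<^sup>2) = U t" by (simp add: d_def U_def power2_norm_eq_inner)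
    finally show ?thesis by (simp add: algebra_simps)
  qed
  have "U t \<le> U 0 * exp (6 * C * n * t)"
    using le by (intro gronwall_exp_bound[OF dU t]) auto
  moreover have "U 0 = 0" using X Y by (simp add: U_def grad_flow_sol_def)
  ultimately have "U t \<le> 0" by simp
  moreover have "(X t i - Y t i) \<bullet> (X t i - Y t i) \<le> U t"
    unfolding U_def by (rule member_le_sum[of i "{..<n}" "\<lambda>i. (X t i - Y t i) \<bullet> (X t i - Y t i)"]) (use i in auto)
  ultimately have "(X t i - Y t i) \<bullet> (X t i - Y t i) \<le> 0" by (rule order_trans[rotated])
  then have "(X t i - Y t i) \<bullet> (X t i - Y t i) = 0" using inner_ge_zero by (rule order_antisym)
  then show ?thesis by simp
qed

sublocale interaction "\<lambda>s. \<phi> (cos s)" "\<lambda>s. - (\<phi>1 (cos s) * sin s)"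
  "\<lambda>s. \<phi>2 (cos s) * (sin s)\<^sup>2 - \<phi>1 (cos s) * cos s"
proof
  fix s
  show "((\<lambda>s. \<phi> (cos s)) has_real_derivative - (\<phi>1 (cos s) * sin s)) (at s)"
    using DERIV_chain'[OF DERIV_cos d\<phi>] by simp
  show "((\<lambda>s. - (\<phi>1 (cos s) * sin s)) has_real_derivative \<phi>2 (cos s) * (sin s)\<^sup>2 - \<phi>1 (cos s) * cos s) (at s)"
    using DERIV_chain'[OF DERIV_cos d\<phi>1]
    by (auto intro!: derivative_eq_intros simp: power2_eq_square)
qed simp

lemma obj_circ: "(\<And>i. i < n \<Longrightarrow> X i = circ (\<theta> i)) \<Longrightarrow> obj \<phi> n X = energy n \<theta>"
  by (simp add: obj_def energy_def inner_circ)

lemma rgrad_circ: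
  assumes "\<And>i. i < n \<Longrightarrow> X i = circ (\<theta> i)" "i < n"
  shows "rgrad (obj \<phi> n) X i = force n i \<theta> *\<^sub>R circ (\<theta> i + pi / 2)"
proof -
  have "pull (X i) (X j) = (- (\<phi>1 (cos (\<theta> i - \<theta> j)) * sin (\<theta> i - \<theta> j))) *\<^sub>R circ (\<theta> i + pi / 2)" if "j < n" for j
  proof -
    have "sin (\<theta> i - \<theta> j) = - sin (\<theta> j - \<theta> i)" by (simp add: sin_diff)
    then show ?thesis
      using assms that by (simp add: pull_def inner_circ circ_minus_proj)
  qed
  then have "(\<Sum>j<n. pull (X i) (X j)) = (\<Sum>j<n. (- (\<phi>1 (cos (\<theta> i - \<theta> j)) * sin (\<theta> i - \<theta> j))) *\<^sub>R circ (\<theta> i + pi / 2))"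
    by (intro sum.cong) auto
  then show ?thesis using assms(2) by (simp only: rgrad_obj force_def scaleR_sum_left)
qed

lemma angle_flow_exists:
  obtains \<theta> where "\<theta> 0 = a"
    "\<And>i t. i < n \<Longrightarrow> t \<ge> 0 \<Longrightarrow> ((\<lambda>s. \<theta> s i) has_real_derivative force n i (\<theta> t)) (at t within {0..})"
proof -
  have b1: "\<bar>- (\<phi>1 (cos s) * sin s)\<bar> \<le> 1" for s
    using mult_mono[OF \<phi>1_le abs_sin_le_one] by (simp add: abs_mult)
  have b2: "\<bar>\<phi>2 (cos s) * (sin s)\<^sup>2 - \<phi>1 (cos s) * cos s\<bar> \<le> L + 1" for s
  proof -
    have "\<bar>\<phi>2 (cos s) * (sin s)\<^sup>2\<bar> \<le> L * 1"
      unfolding abs_mult using \<phi>2_le L_nonneg by (intro mult_mono) (auto simp: abs_square_le_1)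
    moreover have "\<bar>\<phi>1 (cos s) * cos s\<bar> \<le> 1 * 1"
      unfolding abs_mult using \<phi>1_le by (intro mult_mono) auto
    ultimately show ?thesis by linarith
  qed
  have bd: "\<bar>force n i x\<bar> \<le> n" for i x
  proof -
    have "\<bar>force n i x\<bar> \<le> (\<Sum>j<n. \<bar>- (\<phi>1 (cos (x i - x j)) * sin (x i - x j))\<bar>)"
      unfolding force_def by (rule sum_abs)
    also have "\<dots> \<le> (\<Sum>j<n. 1)" by (intro sum_mono b1)
    finally show ?thesis by simp
  qed
  \<comment> \<open>Each of the \<open>n\<close> terms is Lipschitz with constant
    \<open>L + 1\<close> in an angle difference, which varies by at most \<open>2 * D\<close>. The
    added 1 keeps the constant positive when \<open>n = 0\<close>.\<close>
  have lip: "\<bar>force n i x - force n i y\<bar> \<le> (2 * n * (L + 1) + 1) * D"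
    if i: "i < n" and D: "\<And>j. j < n \<Longrightarrow> \<bar>x j - y j\<bar> \<le> D" for i x y D
  proof -
    have "D \<ge> 0" using D[OF i] by linarith
    have "\<bar>force n i x - force n i y\<bar> \<le> (\<Sum>j<n. (L + 1) * (2 * D))"
      unfolding force_def sum_subtractf[symmetric]
    proof (rule order_trans[OF sum_abs sum_mono])
      fix j assume j: "j \<in> {..<n}"
      have "\<bar>- (\<phi>1 (cos (x i - x j)) * sin (x i - x j)) - - (\<phi>1 (cos (y i - y j)) * sin (y i - y j))\<bar>
        \<le> (L + 1) * \<bar>(x i - x j) - (y i - y j)\<bar>"
        by (rule abs_diff_le_of_deriv[OF dh1 b2])
      also have "\<dots> \<le> (L + 1) * (2 * D)"
        using L_nonneg D[OF i] D[of j] j by (intro mult_left_mono) auto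
      finally show "\<bar>- (\<phi>1 (cos (x i - x j)) * sin (x i - x j)) - - (\<phi>1 (cos (y i - y j)) * sin (y i - y j))\<bar>
        \<le> (L + 1) * (2 * D)" .
    qed
    also have "\<dots> \<le> (2 * n * (L + 1) + 1) * D" using \<open>D \<ge> 0\<close> by (simp add: algebra_simps)
    finally show ?thesis .
  qed
  have pos: "2 * n * (L + 1) + 1 > 0" using L_nonneg by (simp add: add_nonneg_pos)
  show thesis
    by (rule bounded_lipschitz_ode_solution[of n "force n" n "2 * n * (L + 1) + 1" a, OF bd lip pos])
       (use that in auto)
qed

lemma grad_flow_sol_circ:
  assumes "\<And>i. i < n \<Longrightarrow> X0 i = circ (\<theta> 0 i)"
    and "\<And>i t. i < n \<Longrightarrow> t \<ge> 0 \<Longrightarrow> ((\<lambda>s. \<theta> s i) has_real_derivative force n i (\<theta> t)) (at t within {0..})"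
  shows "grad_flow_sol n (obj \<phi> n) X0 (\<lambda>t i. circ (\<theta> t i))"
  unfolding grad_flow_sol_def
  using assms by (auto simp: torus_def rgrad_circ[of n _ "\<theta> t" for t] intro!: has_vector_derivative_circ)

end

locale torus_window = radial_kernel +
  concave_window "\<lambda>s. \<phi> (cos s)" "\<lambda>s. - (\<phi>1 (cos s) * sin s)" "\<lambda>s. \<phi>2 (cos s) * (sin s)\<^sup>2 - \<phi>1 (cos s) * cos s"
begin

text \<open>A competitor close to the configuration lifts column by column to angles close to
  \<open>\<theta> i + m\<close>. The energy depends on differences only, so \<open>m\<close> cancels
  and \<open>energy_local_max\<close> applies inside the window.\<close>

lemma local_max_on_torus_circ:
  assumes \<theta>: "\<And>i. i < n \<Longrightarrow> \<bar>\<theta> i - \<alpha> i\<bar> \<le> r" and crit: "\<And>v. slope n \<theta> v = 0"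
  shows "local_max_on_torus n (obj \<phi> n) (\<lambda>i. circ (\<theta> i + m))"
proof -
  \<comment> \<open>The bound 1 keeps \<open>\<rho>\<close> below \<open>pi / 2\<close>, as
    \<open>circ_near\<close> requires.\<close>
  define \<rho> where "\<rho> = min r 1"
  have \<rho>: "0 < \<rho>" "\<rho> < pi / 2" "\<rho> \<le> r" using r pi_gt3 by (auto simp: \<rho>_def)
  have "obj \<phi> n Y \<le> obj \<phi> n (\<lambda>i. circ (\<theta> i + m))"
    if Y: "Y \<in> torus n" and near: "fdist n Y (\<lambda>i. circ (\<theta> i + m)) < sin \<rho>" for Y
  proof -
    have "\<exists>v. \<bar>v\<bar> \<le> \<rho> \<and> Y i = circ (\<theta> i + m + v)" if i: "i < n" for i
    proof -
      have "(norm (Y i - circ (\<theta> i + m)))\<^sup>2 \<le> (\<Sum>i<n. (norm (Y i - circ (\<theta> i + m)))\<^sup>2)"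
        using i by (intro member_le_sum) auto
      then have "norm (Y i - circ (\<theta> i + m)) \<le> fdist n Y (\<lambda>i. circ (\<theta> i + m))"
        unfolding fdist_def by (rule real_le_rsqrt)
      then have "norm (Y i - circ (\<theta> i + m)) < sin \<rho>" using near by simp
      then show ?thesis using circ_near[OF _ \<rho>(1,2)] Y i unfolding torus_def by blast
    qed
    then obtain v where v: "\<And>i. i < n \<Longrightarrow> \<bar>v i\<bar> \<le> \<rho>" "\<And>i. i < n \<Longrightarrow> Y i = circ (\<theta> i + m + v i)"
      by metis
    have "obj \<phi> n Y = energy n (\<lambda>i. \<theta> i + m + v i)" using v by (intro obj_circ)
    also have "\<dots> = energy n (\<lambda>i. \<theta> i + v i)" by (simp add: energy_def algebra_simps)
    also have "\<dots> \<le> energy n \<theta>" using v(1) \<rho> by (intro energy_local_max \<theta> crit) (auto intro: order_trans)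
    also have "\<dots> = energy n (\<lambda>i. \<theta> i + m)" by (simp add: energy_def)
    also have "\<dots> = obj \<phi> n (\<lambda>i. circ (\<theta> i + m))" by (intro obj_circ[symmetric]) simp
    finally show ?thesis .
  qed
  moreover have "sin \<rho> > 0" using \<rho> by (intro sin_gt_zero) auto
  ultimately show ?thesis by (auto simp: local_max_on_torus_def torus_def)
qed

text \<open>By uniqueness every solution is the one built from angles, so it tends to a rotated copy
  of \<open>\<theta>s\<close>. The pair \<open>i0\<close>, \<open>j0\<close> certifies that the copy
  is not synchronized, since a rotation leaves its cosine below 1.\<close>

lemma grad_flow_limit:
  assumes \<theta>s: "\<And>i. i < n \<Longrightarrow> \<bar>\<theta>s i - \<alpha> i\<bar> \<le> r" and crit: "\<And>v. slope n \<theta>s v = 0"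
    and X0: "\<And>i. i < n \<Longrightarrow> X0 i \<in> circ ` {\<theta>s i - r / (2 * (real n + 1)) .. \<theta>s i + r / (2 * (real n + 1))}"
    and ij: "i0 < n" "j0 < n" "cos (\<theta>s i0 - \<theta>s j0) < 1"
  shows "\<exists>\<gamma>. grad_flow_sol n (obj \<phi> n) X0 \<gamma>"
    and "grad_flow_sol n (obj \<phi> n) X0 \<gamma> \<Longrightarrow>
      \<exists>Xs. converges_to n \<gamma> Xs \<and> local_max_on_torus n (obj \<phi> n) Xs \<and> \<not> synchronized n Xs"
proof -
  have "\<forall>i. \<exists>a. i < n \<longrightarrow> \<bar>a - \<theta>s i\<bar> \<le> r / (2 * (real n + 1)) \<and> X0 i = circ a"
  proof
    fix i
    show "\<exists>a. i < n \<longrightarrow> \<bar>a - \<theta>s i\<bar> \<le> r / (2 * (real n + 1)) \<and> X0 i = circ a"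
    proof (cases "i < n")
      case True
      then obtain a where "a \<in> {\<theta>s i - r / (2 * (real n + 1)) .. \<theta>s i + r / (2 * (real n + 1))}" "X0 i = circ a"
        using X0 by blast
      then show ?thesis by (intro exI[of _ a]) (simp add: abs_le_iff)
    qed simp
  qed
  then obtain a where a: "\<And>i. i < n \<Longrightarrow> \<bar>a i - \<theta>s i\<bar> \<le> r / (2 * (real n + 1))" "\<And>i. i < n \<Longrightarrow> X0 i = circ (a i)"
    by metis
  obtain \<theta> where \<theta>0: "\<theta> 0 = a" and \<theta>: "\<And>i t. i < n \<Longrightarrow> t \<ge> 0 \<Longrightarrow>
      ((\<lambda>s. \<theta> s i) has_real_derivative force n i (\<theta> t)) (at t within {0..})"
    using angle_flow_exists[of a n] by blast
  have sol: "grad_flow_sol n (obj \<phi> n) X0 (\<lambda>t i. circ (\<theta> t i))"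
    using a \<theta>0 \<theta> by (intro grad_flow_sol_circ) auto
  then show "\<exists>\<gamma>. grad_flow_sol n (obj \<phi> n) X0 \<gamma>" by blast
  obtain m where m: "\<And>i. i < n \<Longrightarrow> ((\<lambda>t. \<theta> t i) \<longlongrightarrow> \<theta>s i + m) at_top"
    using flow_converges[OF \<theta>s crit \<theta>] a \<theta>0 by blast
  assume \<gamma>: "grad_flow_sol n (obj \<phi> n) X0 \<gamma>"
  have "converges_to n \<gamma> (\<lambda>i. circ (\<theta>s i + m))"
    unfolding converges_to_def
  proof (intro allI impI)
    fix i assume i: "i < n"
    have "((\<lambda>t. circ (\<theta> t i)) \<longlongrightarrow> circ (\<theta>s i + m)) at_top"
      by (intro tendsto_circ m i)
    moreover have "\<forall>\<^sub>F t in at_top. circ (\<theta> t i) = \<gamma> t i"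
      using eventually_ge_at_top[of 0]
      by (rule eventually_mono) (use grad_flow_unique[OF sol \<gamma> _ i] in auto)
    ultimately show "((\<lambda>t. \<gamma> t i) \<longlongrightarrow> circ (\<theta>s i + m)) at_top"
      by (rule Lim_transform_eventually)
  qed
  moreover have "\<not> synchronized n (\<lambda>i. circ (\<theta>s i + m))"
  proof
    assume "synchronized n (\<lambda>i. circ (\<theta>s i + m))"
    then have "circ (\<theta>s i0 + m) = circ (\<theta>s j0 + m)" using ij unfolding synchronized_def by blast
    then have "circ (\<theta>s i0 + m) \<bullet> circ (\<theta>s j0 + m) = 1"
      by (metis inner_circ cos_zero diff_self)
    then show False using ij by (simp add: inner_circ)
  qed
  ultimately show "\<exists>Xs. converges_to n \<gamma> Xs \<and> local_max_on_torus n (obj \<phi> n) Xs \<and> \<not> synchronized n Xs"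
    using local_max_on_torus_circ[OF \<theta>s crit] by blast
qed

end

section \<open>Boxes of initial points\<close>

text \<open>The preimage of the box contains a product of intervals of angles, and these have
  positive length once the centres are reduced modulo \<open>2 * pi\<close>.\<close>

lemma emeasure_unif_torus_box:
  fixes n :: nat and a :: "nat \<Rightarrow> real"
  assumes \<delta>: "\<delta> > 0"
  defines "A \<equiv> PiE {..<n} (\<lambda>i. circ ` {a i - \<delta> .. a i + \<delta>})"
  shows "A \<in> sets (unif_torus n)" "emeasure (unif_torus n) A > 0"
proof -
  define U where "U = uniform_measure lborel {0..2 * pi}"
  have U: "prob_space U" unfolding U_def by (rule prob_space_uniform_measure) auto
  have sU: "sets U = sets borel" by (simp add: U_def)
  have circ: "circ \<in> borel_measurable borel"
    by (rule borel_measurable_continuous_onI[OF continuous_on_circ])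
  have f: "(\<lambda>\<theta>. \<lambda>i\<in>{..<n}. circ (\<theta> i)) \<in> measurable (PiM {..<n} (\<lambda>_. U)) (PiM {..<n} (\<lambda>_. borel))"
  proof (rule measurable_restrict)
    fix i assume "i \<in> {..<n}"
    then have "(\<lambda>\<theta>. \<theta> i) \<in> measurable (PiM {..<n} (\<lambda>_. U)) borel"
      using measurable_component_singleton[of i "{..<n}" "\<lambda>_. U"] by (simp add: sU cong: measurable_cong_sets)
    then show "(\<lambda>\<theta>. circ (\<theta> i)) \<in> measurable (PiM {..<n} (\<lambda>_. U)) borel"
      using circ by (rule measurable_compose)
  qed
  have "circ ` {a i - \<delta> .. a i + \<delta>} \<in> sets borel" for i
    by (intro borel_closed compact_imp_closed compact_continuous_image continuous_on_circ) simp
  then have A: "A \<in> sets (PiM {..<n} (\<lambda>_. borel))"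
    unfolding A_def by (intro sets_PiM_I_finite) auto
  then show "A \<in> sets (unif_torus n)" by (simp add: unif_torus_def)
  define b where "b i = a i - 2 * pi * of_int \<lfloor>a i / (2 * pi)\<rfloor>" for i
  have b: "0 \<le> b i" "b i < 2 * pi" for i
  proof -
    have "of_int \<lfloor>a i / (2 * pi)\<rfloor> * (2 * pi) \<le> a i / (2 * pi) * (2 * pi)"
      by (intro mult_right_mono) auto
    then show "0 \<le> b i" by (simp add: b_def mult.commute)
    have "a i / (2 * pi) * (2 * pi) < (of_int \<lfloor>a i / (2 * pi)\<rfloor> + 1) * (2 * pi)"
      by (intro mult_strict_right_mono) auto
    then show "b i < 2 * pi" by (simp add: b_def algebra_simps)
  qed
  \<comment> \<open>Only the part of the interval to the right of \<open>b i\<close> and up to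
    \<open>2 * pi\<close> is kept. It stays within one period, and \<open>b i < 2 * pi\<close> gives
    it positive length.\<close>
  define e where "e i = min (b i + \<delta>) (2 * pi)" for i
  have be: "b i < e i" "e i \<le> 2 * pi" for i using b[of i] \<delta> by (auto simp: e_def)
  define J where "J i = {b i .. e i}" for i
  have J: "circ x \<in> circ ` {a i - \<delta> .. a i + \<delta>}" if "x \<in> J i" for x i
  proof (rule image_eqI)
    show "circ x = circ (x + 2 * pi * of_int \<lfloor>a i / (2 * pi)\<rfloor>)"
      by (rule vec2_eqI) (simp_all add: cos_add sin_add)
    show "x + 2 * pi * of_int \<lfloor>a i / (2 * pi)\<rfloor> \<in> {a i - \<delta> .. a i + \<delta>}"
      using that \<delta> by (auto simp: J_def e_def b_def)
  qed
  have "PiE {..<n} J \<subseteq> (\<lambda>\<theta>. \<lambda>i\<in>{..<n}. circ (\<theta> i)) -` A \<inter> space (PiM {..<n} (\<lambda>_. U))"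
    using J by (auto simp: A_def space_PiM U_def PiE_iff)
  then have "emeasure (PiM {..<n} (\<lambda>_. U)) (PiE {..<n} J)
    \<le> emeasure (PiM {..<n} (\<lambda>_. U)) ((\<lambda>\<theta>. \<lambda>i\<in>{..<n}. circ (\<theta> i)) -` A \<inter> space (PiM {..<n} (\<lambda>_. U)))"
    using measurable_sets[OF f A] by (rule emeasure_mono)
  also have "\<dots> = emeasure (unif_torus n) A"
    unfolding unif_torus_def U_def[symmetric] by (rule emeasure_distr[OF f A, symmetric])
  finally have le: "emeasure (PiM {..<n} (\<lambda>_. U)) (PiE {..<n} J) \<le> emeasure (unif_torus n) A" .
  interpret product_sigma_finite "\<lambda>_::nat. U"
    using U by (simp add: product_sigma_finite_def prob_space_imp_sigma_finite)
  have "emeasure U (J i) = ennreal ((e i - b i) / (2 * pi))" for i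
  proof -
    have "{0..2 * pi} \<inter> J i = J i" using b[of i] be[of i] by (auto simp: J_def)
    then have "emeasure U (J i) = ennreal (e i - b i) / ennreal (2 * pi)"
      using be[of i] by (simp add: U_def J_def)
    also have "\<dots> = ennreal ((e i - b i) / (2 * pi))"
      using be[of i] by (intro divide_ennreal) auto
    finally show ?thesis .
  qed
  then have "emeasure (PiM {..<n} (\<lambda>_. U)) (PiE {..<n} J) = (\<Prod>i<n. ennreal ((e i - b i) / (2 * pi)))"
    by (subst emeasure_PiM) (auto simp: sU J_def)
  also have "\<dots> = ennreal (\<Prod>i<n. (e i - b i) / (2 * pi))"
    using be by (intro prod_ennreal) (auto simp: less_imp_le)
  also have "\<dots> > 0" using be by (auto intro!: prod_pos)
  finally show "emeasure (unif_torus n) A > 0" using le by simp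
qed

section \<open>Polygonal configurations and the softplus kernel\<close>

lemma sum_nat_split_add: "(\<Sum>j<m + k. f j) = (\<Sum>j<m. f j) + (\<Sum>j<k. f (m + j :: nat))"
  for f :: "nat \<Rightarrow> real"
  by (induction k) simp_all

text \<open>Raising \<open>i\<close> by one only moves one term by a full period, so the sum does
  not depend on \<open>i\<close>. Reversing the order of the terms at \<open>i = m - 1\<close> gives
  minus the sum at \<open>i = 0\<close>. This is why a regular polygon is critical.\<close>

lemma sum_odd_periodic_eq_0:
  fixes G :: "real \<Rightarrow> real"
  assumes m: "m > 0" and per: "\<And>x. G (x - real m) = G x" and odd: "\<And>x. G (- x) = - G x"
  shows "(\<Sum>j<m. G (real i - real j)) = 0"
proof -
  obtain k where k: "m = Suc k" using m gr0_implies_Suc by blast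
  have shift: "(\<Sum>j<m. G (real i - real j)) = (\<Sum>j<m. G (0 - real j))" for i
  proof (induction i)
    case (Suc i)
    have "(\<Sum>j<m. G (real (Suc i) - real j)) = G (real (Suc i)) + (\<Sum>j<k. G (real i - real j))"
      unfolding k by (subst sum.lessThan_Suc_shift) simp
    also have "G (real (Suc i)) = G (real i - real k)"
      using per[of "real (Suc i)"] by (simp add: k)
    also have "\<dots> + (\<Sum>j<k. G (real i - real j)) = (\<Sum>j<m. G (real i - real j))"
      unfolding k by simp
    finally show ?case using Suc by simp
  qed simp
  have "(\<Sum>j<m. G (real k - real j)) = (\<Sum>j<m. G (real (m - Suc j)))"
    by (intro sum.cong refl arg_cong[of _ _ G]) (auto simp: k of_nat_diff)
  also have "\<dots> = (\<Sum>j<m. G (real j))" by (rule sum.nat_diff_reindex)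
  also have "\<dots> = - (\<Sum>j<m. G (0 - real j))" by (simp add: odd sum_negf)
  finally have "(\<Sum>j<m. G (0 - real j)) = 0" using shift[of k] by simp
  then show ?thesis using shift[of i] by simp
qed

text \<open>Complete turns around the polygon cancel; at most \<open>n mod m\<close> terms are left
  over.\<close>

lemma abs_sum_odd_periodic_le:
  fixes G :: "real \<Rightarrow> real"
  assumes m: "m > 0" and per: "\<And>x. G (x - real m) = G x" and odd: "\<And>x. G (- x) = - G x"
    and bd: "\<And>x. \<bar>G x\<bar> \<le> 1"
  shows "\<bar>\<Sum>j<n. G (real i - real j)\<bar> \<le> real (n mod m)"
proof (induction n rule: less_induct)
  case (less n)
  show ?case
  proof (cases "n < m")
    case True
    have "\<bar>\<Sum>j<n. G (real i - real j)\<bar> \<le> (\<Sum>j<n. 1)"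
      using bd by (intro order_trans[OF sum_abs] sum_mono) auto
    then show ?thesis using True by simp
  next
    case False
    then obtain k where n: "n = m + k" using le_Suc_ex not_less by blast
    have "G (real i - real (m + j)) = G (real i - real j)" for j
      using per[of "real i - real j"] by (simp add: algebra_simps)
    then have "(\<Sum>j<n. G (real i - real j)) = (\<Sum>j<k. G (real i - real j))"
      unfolding n sum_nat_split_add using sum_odd_periodic_eq_0[OF m per odd, of i] by simp
    then show ?thesis using less[of k] m n by simp
  qed
qed

section \<open>Poincare inequalities for two kinds of graphs\<close>

text \<open>Every edge of the path contributes at most \<open>sqrt R\<close>, so two values differ
  by at most \<open>2 * n * sqrt R\<close>; squaring and summing over all pairs gives
  \<open>4 * n ^ 4\<close>. The growth in \<open>n\<close> is harmless for the finitely many small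
  n-gons.\<close>

lemma sum_sq_diff_le_path:
  fixes v :: "nat \<Rightarrow> real"
  assumes adj: "\<And>k. Suc k < n \<Longrightarrow> P (Suc k) k"
  shows "(\<Sum>i<n. \<Sum>j<n. (v i - v j)\<^sup>2) \<le> 4 * real n ^ 4 * (\<Sum>i<n. \<Sum>j<n. if P i j then (v i - v j)\<^sup>2 else 0)"
proof -
  define R where "R = (\<Sum>i<n. \<Sum>j<n. if P i j then (v i - v j)\<^sup>2 else 0)"
  have R: "R \<ge> 0" unfolding R_def by (intro sum_nonneg) auto
  have step: "\<bar>v (Suc k) - v k\<bar> \<le> sqrt R" if "Suc k < n" for k
  proof -
    have "(v (Suc k) - v k)\<^sup>2 = (if P (Suc k) k then (v (Suc k) - v k)\<^sup>2 else 0)"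
      using adj[OF that] by simp
    also have "\<dots> \<le> (\<Sum>j<n. if P (Suc k) j then (v (Suc k) - v j)\<^sup>2 else 0)"
      using that by (intro member_le_sum) auto
    also have "\<dots> \<le> R"
      unfolding R_def using that by (intro member_le_sum) (auto intro!: sum_nonneg)
    finally show ?thesis using real_le_rsqrt real_sqrt_le_iff by (metis real_sqrt_abs)
  qed
  have path: "\<bar>v i - v 0\<bar> \<le> real i * sqrt R" if "i < n" for i
    using that
  proof (induction i)
    case (Suc i)
    then show ?case using step[of i] by (simp add: distrib_right)
  qed simp
  have "(v i - v j)\<^sup>2 \<le> 4 * (real n)\<^sup>2 * R" if "i < n" "j < n" for i j
  proof -
    have "real i * sqrt R \<le> real n * sqrt R" "real j * sqrt R \<le> real n * sqrt R"
      using that R by (auto intro!: mult_right_mono)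
    then have "\<bar>v i - v j\<bar> \<le> \<bar>2 * real n * sqrt R\<bar>"
      using path[OF that(1)] path[OF that(2)] R by simp
    then have "(v i - v j)\<^sup>2 \<le> (2 * real n * sqrt R)\<^sup>2" by (simp only: abs_le_square_iff)
    then show ?thesis using R by (simp add: power_mult_distrib)
  qed
  then have "(\<Sum>i<n. \<Sum>j<n. (v i - v j)\<^sup>2) \<le> (\<Sum>i<n. \<Sum>j<n. 4 * (real n)\<^sup>2 * R)"
    by (intro sum_mono) auto
  also have "\<dots> = 4 * real n ^ 4 * R" by (simp add: power2_eq_square power4_eq_xxxx)
  finally show ?thesis by (simp add: R_def)
qed

text \<open>A non-adjacent pair is joined by at least \<open>q\<close> paths of length two, and
  averaging over them bounds its square by edge terms. With \<open>q\<close> proportional to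
  \<open>n\<close> the constant does not depend on \<open>n\<close>, as large configurations
  require.\<close>

lemma sum_sq_diff_le_common_neighbours:
  fixes v :: "nat \<Rightarrow> real"
  assumes common: "\<And>i j. i < n \<Longrightarrow> j < n \<Longrightarrow> \<not> P i j \<Longrightarrow> q \<le> card {k\<in>{..<n}. P i k \<and> P k j}"
    and q: "q > 0" and nq: "n \<le> B * q"
  shows "(\<Sum>i<n. \<Sum>j<n. (v i - v j)\<^sup>2) \<le> (4 * real B + 1) * (\<Sum>i<n. \<Sum>j<n. if P i j then (v i - v j)\<^sup>2 else 0)"
proof -
  define w where "w i j = (if P i j then (v i - v j)\<^sup>2 else 0)" for i j
  define R where "R = (\<Sum>i<n. \<Sum>j<n. w i j)"
  have w: "w i j \<ge> 0" for i j by (simp add: w_def)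
  then have R: "R \<ge> 0" unfolding R_def by (intro sum_nonneg)
  have term_le: "real q * (v i - v j)\<^sup>2 \<le> real q * w i j + (\<Sum>k<n. 2 * w i k + 2 * w k j)" if "i < n" "j < n" for i j
  proof (cases "P i j")
    case True
    then show ?thesis using w by (simp add: w_def[of i j] sum_nonneg)
  next
    case False
    have "real q * (v i - v j)\<^sup>2 \<le> real (card {k\<in>{..<n}. P i k \<and> P k j}) * (v i - v j)\<^sup>2"
      using common[OF that False] by (intro mult_right_mono) auto
    also have "\<dots> = (\<Sum>k\<in>{k\<in>{..<n}. P i k \<and> P k j}. (v i - v j)\<^sup>2)" by simp
    also have "\<dots> \<le> (\<Sum>k\<in>{k\<in>{..<n}. P i k \<and> P k j}. 2 * w i k + 2 * w k j)"
    proof (rule sum_mono)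
      fix k assume "k \<in> {k\<in>{..<n}. P i k \<and> P k j}"
      moreover have "(v i - v j)\<^sup>2 \<le> 2 * (v i - v k)\<^sup>2 + 2 * (v k - v j)\<^sup>2"
        using zero_le_power2[of "(v i - v k) - (v k - v j)"]
        by (simp add: power2_eq_square algebra_simps)
      ultimately show "(v i - v j)\<^sup>2 \<le> 2 * w i k + 2 * w k j" by (simp add: w_def)
    qed
    also have "\<dots> \<le> (\<Sum>k<n. 2 * w i k + 2 * w k j)"
      using w by (intro sum_mono2) auto
    finally show ?thesis using w[of i j] by (simp add: add_increasing)
  qed
  have "real q * (\<Sum>i<n. \<Sum>j<n. (v i - v j)\<^sup>2) = (\<Sum>i<n. \<Sum>j<n. real q * (v i - v j)\<^sup>2)"
    by (simp add: sum_distrib_left)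
  also have "\<dots> \<le> (\<Sum>i<n. \<Sum>j<n. real q * w i j + (\<Sum>k<n. 2 * w i k + 2 * w k j))"
    by (intro sum_mono term_le) auto
  also have "\<dots> = real q * R + (2 * (\<Sum>i<n. \<Sum>j<n. \<Sum>k<n. w i k) + 2 * (\<Sum>i<n. \<Sum>j<n. \<Sum>k<n. w k j))"
    by (simp only: R_def sum.distrib sum_distrib_left)
  also have "(\<Sum>i<n. \<Sum>j<n. \<Sum>k<n. w i k) = real n * R"
    by (simp add: R_def sum_distrib_left)
  also have "(\<Sum>i<n. \<Sum>j<n. \<Sum>k<n. w k j) = real n * R"
    unfolding R_def by (subst (2) sum.swap) simp
  also have "real q * R + (2 * (real n * R) + 2 * (real n * R)) \<le> real q * ((4 * real B + 1) * R)"
  proof -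
    have "real n * R \<le> real (B * q) * R" using nq R by (intro mult_right_mono) linarith+
    then show ?thesis by (simp add: algebra_simps)
  qed
  finally show ?thesis using q by (simp add: R_def w_def)
qed

section \<open>Derivatives and tails of the softplus kernel\<close>

definition phi1 :: "real \<Rightarrow> real \<Rightarrow> real \<Rightarrow> real" where
  "phi1 \<epsilon> \<tau> t = exp ((t - \<tau>) / \<epsilon>) / (1 + exp ((t - \<tau>) / \<epsilon>))"

definition phi2 :: "real \<Rightarrow> real \<Rightarrow> real \<Rightarrow> real" where
  "phi2 \<epsilon> \<tau> t = exp ((t - \<tau>) / \<epsilon>) / (1 + exp ((t - \<tau>) / \<epsilon>))\<^sup>2 / \<epsilon>"

lemma one_plus_exp_pos: "0 < 1 + exp (x :: real)" "1 + exp x \<noteq> 0"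
  using exp_gt_zero[of x] by linarith+

lemma
  assumes "\<epsilon> > 0"
  shows DERIV_phi: "(phi \<epsilon> \<tau> has_real_derivative phi1 \<epsilon> \<tau> t) (at t)"
    and DERIV_phi1: "(phi1 \<epsilon> \<tau> has_real_derivative phi2 \<epsilon> \<tau> t) (at t)"
proof -
  define x where "x = (t - \<tau>) / \<epsilon>"
  have dx: "((\<lambda>t. 1 + exp ((t - \<tau>) / \<epsilon>)) has_real_derivative exp x / \<epsilon>) (at t)"
    using assms by (auto intro!: derivative_eq_intros simp: x_def)
  have pos: "0 < 1 + exp x" "1 + exp x \<noteq> 0" by (rule one_plus_exp_pos)+
  have "((\<lambda>t. \<epsilon> * ln (1 + exp ((t - \<tau>) / \<epsilon>))) has_real_derivative \<epsilon> * (1 / (1 + exp x) * (exp x / \<epsilon>))) (at t)"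
    using pos(1) unfolding x_def by (intro DERIV_cmult DERIV_chain'[OF dx[unfolded x_def]] DERIV_ln_divide)
  also have "\<epsilon> * (1 / (1 + exp x) * (exp x / \<epsilon>)) = phi1 \<epsilon> \<tau> t"
    using assms by (simp add: phi1_def x_def)
  finally show "(phi \<epsilon> \<tau> has_real_derivative phi1 \<epsilon> \<tau> t) (at t)"
    by (simp add: phi_def[abs_def])
  \<comment> \<open>Written as one minus a reciprocal, \<open>phi1\<close> needs only the rule for
    inverses.\<close>
  have "((\<lambda>t. 1 - inverse (1 + exp ((t - \<tau>) / \<epsilon>))) has_real_derivative
      0 - - (inverse (1 + exp x) * (exp x / \<epsilon>) * inverse (1 + exp x))) (at t)"
    using pos(2) unfolding x_def
    by (intro DERIV_diff DERIV_const DERIV_inverse'[OF dx[unfolded x_def]])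
  then have "((\<lambda>t. 1 - inverse (1 + exp ((t - \<tau>) / \<epsilon>))) has_real_derivative phi2 \<epsilon> \<tau> t) (at t)"
    by (simp add: phi2_def x_def power2_eq_square divide_inverse mult_ac)
  moreover have "(\<lambda>t. 1 - inverse (1 + exp ((t - \<tau>) / \<epsilon>))) = phi1 \<epsilon> \<tau>"
  proof
    fix t
    show "1 - inverse (1 + exp ((t - \<tau>) / \<epsilon>)) = phi1 \<epsilon> \<tau> t"
      using one_plus_exp_pos(2)[of "(t - \<tau>) / \<epsilon>"] by (simp add: phi1_def divide_simps)
  qed
  ultimately show "(phi1 \<epsilon> \<tau> has_real_derivative phi2 \<epsilon> \<tau> t) (at t)" by simp
qed

lemma phi1_bounds: "0 \<le> phi1 \<epsilon> \<tau> t" "phi1 \<epsilon> \<tau> t \<le> 1"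
  using one_plus_exp_pos[of "(t - \<tau>) / \<epsilon>"] by (auto simp: phi1_def)

lemma phi2_nonneg: "\<epsilon> > 0 \<Longrightarrow> 0 \<le> phi2 \<epsilon> \<tau> t"
  by (simp add: phi2_def)

text \<open>Away from the threshold \<open>phi1\<close> is exponentially close to a step function.
  As \<open>phi2\<close> equals \<open>phi1 * (1 - phi1) / \<epsilon>\<close>, it is small on both
  sides, because one factor is.\<close>

lemma
  assumes \<epsilon>: "\<epsilon> > 0"
  shows phi1_ge: "t \<ge> \<tau> + d \<Longrightarrow> 1 - exp (- d / \<epsilon>) \<le> phi1 \<epsilon> \<tau> t"
    and phi1_le: "t \<le> \<tau> - d \<Longrightarrow> phi1 \<epsilon> \<tau> t \<le> exp (- d / \<epsilon>)"
    and phi2_le: "\<bar>t - \<tau>\<bar> \<ge> d \<Longrightarrow> phi2 \<epsilon> \<tau> t \<le> exp (- d / \<epsilon>) / \<epsilon>"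
proof -
  define x where "x = (t - \<tau>) / \<epsilon>"
  have pos: "0 < 1 + exp x" "1 + exp x \<noteq> 0" by (rule one_plus_exp_pos)+
  have lo: "1 - phi1 \<epsilon> \<tau> t \<le> exp (- x)"
  proof -
    have "1 - phi1 \<epsilon> \<tau> t = 1 / (1 + exp x)" using pos by (simp add: phi1_def x_def[symmetric] field_simps)
    also have "\<dots> \<le> 1 / exp x" by (intro divide_left_mono) (auto simp: pos)
    finally show ?thesis by (simp add: exp_minus inverse_eq_divide)
  qed
  have hi: "phi1 \<epsilon> \<tau> t \<le> exp x"
  proof -
    have "exp x / (1 + exp x) \<le> exp x / 1" by (intro divide_left_mono) (auto simp: pos)
    then show ?thesis by (simp add: phi1_def x_def)
  qed
  have p2: "phi2 \<epsilon> \<tau> t = phi1 \<epsilon> \<tau> t * (1 - phi1 \<epsilon> \<tau> t) / \<epsilon>"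
    using pos by (simp add: phi1_def phi2_def x_def[symmetric] field_simps power2_eq_square)
  have x1: "d / \<epsilon> \<le> x" if "t \<ge> \<tau> + d"
    unfolding x_def using that \<epsilon> by (intro divide_right_mono) auto
  have x2: "x \<le> - d / \<epsilon>" if "t \<le> \<tau> - d"
    unfolding x_def using that \<epsilon> by (intro divide_right_mono) auto
  show ge: "1 - exp (- d / \<epsilon>) \<le> phi1 \<epsilon> \<tau> t" if "t \<ge> \<tau> + d"
  proof -
    have "exp (- x) \<le> exp (- d / \<epsilon>)" using x1[OF that] by simp
    then show ?thesis using lo by linarith
  qed
  show le: "phi1 \<epsilon> \<tau> t \<le> exp (- d / \<epsilon>)" if "t \<le> \<tau> - d"
  proof -
    have "exp x \<le> exp (- d / \<epsilon>)" using x2[OF that] by simp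
    then show ?thesis using hi by linarith
  qed
  show "phi2 \<epsilon> \<tau> t \<le> exp (- d / \<epsilon>) / \<epsilon>" if "\<bar>t - \<tau>\<bar> \<ge> d"
  proof -
    have "phi1 \<epsilon> \<tau> t * (1 - phi1 \<epsilon> \<tau> t) \<le> exp (- d / \<epsilon>)"
    proof (cases "t \<ge> \<tau> + d")
      case True
      then show ?thesis
        using ge[OF True] phi1_bounds[of \<epsilon> \<tau> t] mult_left_le_one_le[of "1 - phi1 \<epsilon> \<tau> t" "phi1 \<epsilon> \<tau> t"] by linarith
    next
      case False
      then have "t \<le> \<tau> - d" using that by linarith
      then show ?thesis
        using le phi1_bounds[of \<epsilon> \<tau> t] mult_right_le_one_le[of "phi1 \<epsilon> \<tau> t" "1 - phi1 \<epsilon> \<tau> t"] by linarith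
    qed
    then show ?thesis unfolding p2 using \<epsilon> by (intro divide_right_mono) auto
  qed
qed

lemma radial_kernel_phi:
  assumes "\<epsilon> > 0"
  shows "radial_kernel (phi \<epsilon> \<tau>) (phi1 \<epsilon> \<tau>) (phi2 \<epsilon> \<tau>) (1 / \<epsilon>)"
proof
  fix t
  show "(phi \<epsilon> \<tau> has_real_derivative phi1 \<epsilon> \<tau> t) (at t)" "(phi1 \<epsilon> \<tau> has_real_derivative phi2 \<epsilon> \<tau> t) (at t)"
    using assms by (rule DERIV_phi DERIV_phi1)+
  show "\<bar>phi1 \<epsilon> \<tau> t\<bar> \<le> 1" using phi1_bounds[of \<epsilon> \<tau> t] by simp
  \<comment> \<open>The global bound is the tail estimate at distance 0.\<close>
  show "\<bar>phi2 \<epsilon> \<tau> t\<bar> \<le> 1 / \<epsilon>"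
    using phi2_le[of \<epsilon> 0 t \<tau>] phi2_nonneg[of \<epsilon> \<tau> t] assms by simp
qed

lemma abs_cos_diff_le: "\<bar>cos x - cos y\<bar> \<le> \<bar>x - y :: real\<bar>"
  using field_differentiable_bound[of UNIV cos "\<lambda>x. - sin x" 1 x y]
  by (auto intro!: derivative_eq_intros)

text \<open>Bounds the second derivative of \<open>phi (cos s)\<close> at non-edges: the summand
  with \<open>1 / \<epsilon>\<close> comes from \<open>phi2\<close>, the other one from
  \<open>phi1\<close>.\<close>

definition tail :: "real \<Rightarrow> real \<Rightarrow> real" where
  "tail d \<epsilon> = exp (- d / \<epsilon>) * (1 / \<epsilon> + 1)"

lemma tail_tendsto_0: "d > 0 \<Longrightarrow> (tail d \<longlongrightarrow> 0) (at_right 0)"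
  unfolding tail_def[abs_def] by real_asymp

text \<open>With radius \<open>d / 4\<close> the window lets an angle difference, and so its cosine,
  move by at most \<open>d\<close>; half of the gap \<open>2 * d\<close> survives. On an edge the
  cosine is then at least \<open>\<tau> + d \<ge> d\<close>, so the second derivative is at most
  \<open>tail d \<epsilon> - d\<close>, which is at most \<open>- d / 2\<close>.\<close>

lemma torus_window_polygon:
  fixes n m :: nat and d K \<epsilon> \<tau> :: real
  defines "\<alpha> \<equiv> (\<lambda>i. 2 * pi * real i / real m)"
  assumes n: "n > 0" and \<tau>: "0 \<le> \<tau>" "\<tau> < 1" and \<epsilon>: "\<epsilon> > 0" and d: "d > 0" and K: "K > 0"
    and gap: "\<And>i j. i < n \<Longrightarrow> j < n \<Longrightarrow> 2 * d \<le> \<bar>cos (\<alpha> i - \<alpha> j) - \<tau>\<bar>"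
    and edges: "\<And>v :: nat \<Rightarrow> real. (\<Sum>i<n. \<Sum>j<n. (v i - v j)\<^sup>2)
      \<le> K * (\<Sum>i<n. \<Sum>j<n. if cos (\<alpha> i - \<alpha> j) > \<tau> then (v i - v j)\<^sup>2 else 0)"
    and tail: "tail d \<epsilon> \<le> d / 2" "tail d \<epsilon> * K \<le> d / 4"
  shows "torus_window (phi \<epsilon> \<tau>) (phi1 \<epsilon> \<tau>) (phi2 \<epsilon> \<tau>) (1 / \<epsilon>) n \<alpha> (d / 4) (d / (4 * K))
    (\<lambda>i j. if cos (\<alpha> i - \<alpha> j) > \<tau> then - d / 2 else tail d \<epsilon>)"
proof -
  interpret radial_kernel "phi \<epsilon> \<tau>" "phi1 \<epsilon> \<tau>" "phi2 \<epsilon> \<tau>" "1 / \<epsilon>"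
    using \<epsilon> by (rule radial_kernel_phi)
  define e where "e = exp (- d / \<epsilon>)"
  have e: "0 < e" "e \<le> 1" using d \<epsilon> by (auto simp: e_def)
  have tl: "tail d \<epsilon> = e / \<epsilon> + e" by (simp add: tail_def e_def algebra_simps)
  have tl0: "tail d \<epsilon> \<ge> 0" using e \<epsilon> by (simp add: tl)
  \<comment> \<open>A point paired with itself has cosine 1, so the gap bounds \<open>2 * d\<close>
    by \<open>1 - \<tau>\<close>.\<close>
  have d1: "d \<le> 1" using gap[of 0 0] n \<tau> d by (simp add: abs_if split: if_splits)
  show ?thesis
  proof
    show "d / 4 > 0" "d / (4 * K) > 0" "n > 0" using d K n by auto
  next
    fix i j s
    assume ij: "i < n" "j < n" and s: "\<bar>s - (\<alpha> i - \<alpha> j)\<bar> \<le> 4 * (d / 4)"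
    have cs: "\<bar>cos s - cos (\<alpha> i - \<alpha> j)\<bar> \<le> d" using abs_cos_diff_le[of s "\<alpha> i - \<alpha> j"] s by linarith
    have far: "\<bar>cos s - \<tau>\<bar> \<ge> d" using cs gap[OF ij] by linarith
    have "phi2 \<epsilon> \<tau> (cos s) * (sin s)\<^sup>2 \<le> e / \<epsilon> * 1"
      using phi2_le[OF \<epsilon> far] phi2_nonneg[OF \<epsilon>] e \<epsilon>
      by (intro mult_mono) (auto simp: e_def abs_square_le_1)
    moreover have "- (phi1 \<epsilon> \<tau> (cos s) * cos s) \<le> (if cos (\<alpha> i - \<alpha> j) > \<tau> then e - d else e)"
    proof (cases "cos (\<alpha> i - \<alpha> j) > \<tau>")
      case True
      then have c: "cos s \<ge> \<tau> + d" using cs gap[OF ij] by linarith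
      have "(1 - e) * d \<le> phi1 \<epsilon> \<tau> (cos s) * cos s"
        using phi1_ge[OF \<epsilon> c] c \<tau> d phi1_bounds(1)[of \<epsilon> \<tau> "cos s"]
        by (intro mult_mono) (auto simp: e_def)
      moreover have "e * d \<le> e" using e d1 d by (simp add: mult_left_le)
      ultimately show ?thesis using True by (simp add: algebra_simps)
    next
      case False
      then have c: "cos s \<le> \<tau> - d" using cs gap[OF ij] by linarith
      have "phi1 \<epsilon> \<tau> (cos s) * (- cos s) \<le> e * 1"
        using phi1_le[OF \<epsilon> c] phi1_bounds(1)[of \<epsilon> \<tau> "cos s"] cos_ge_minus_one[of s] e
        by (intro order_trans[OF mult_left_mono[of "- cos s" 1] mult_right_mono]) (auto simp: e_def)
      then show ?thesis using False by simp
    qed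
    ultimately show "phi2 \<epsilon> \<tau> (cos s) * (sin s)\<^sup>2 - phi1 \<epsilon> \<tau> (cos s) * cos s
      \<le> (if cos (\<alpha> i - \<alpha> j) > \<tau> then - d / 2 else tail d \<epsilon>)"
      using tail(1)[unfolded tl] by (cases "cos (\<alpha> i - \<alpha> j) > \<tau>"; simp only: if_True if_False tl; linarith)
  next
    fix v :: "nat \<Rightarrow> real"
    define R where "R = (\<Sum>i<n. \<Sum>j<n. if cos (\<alpha> i - \<alpha> j) > \<tau> then (v i - v j)\<^sup>2 else 0)"
    define Q where "Q = (\<Sum>i<n. \<Sum>j<n. (v i - v j)\<^sup>2)"
    have R: "R \<ge> 0" unfolding R_def by (intro sum_nonneg) auto
    have QR: "Q \<le> K * R" unfolding Q_def R_def by (rule edges)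
    have "(\<Sum>i<n. \<Sum>j<n. (if cos (\<alpha> i - \<alpha> j) > \<tau> then - d / 2 else tail d \<epsilon>) * (v i - v j)\<^sup>2)
      \<le> (\<Sum>i<n. \<Sum>j<n. - (d / 2) * (if cos (\<alpha> i - \<alpha> j) > \<tau> then (v i - v j)\<^sup>2 else 0) + tail d \<epsilon> * (v i - v j)\<^sup>2)"
      using tl0 by (intro sum_mono) auto
    also have "\<dots> = - (d / 2) * R + tail d \<epsilon> * Q"
      unfolding R_def Q_def sum_distrib_left sum.distrib ..
    \<comment> \<open>The Poincare inequality lets the edges pay for the non-edges: the latter use
      up half of \<open>(d / 2) * R\<close>, and the other half becomes coercivity in
      \<open>Q\<close>.\<close>
    also have "tail d \<epsilon> * Q \<le> tail d \<epsilon> * (K * R)" using QR tl0 by (rule mult_left_mono)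
    also have "\<dots> \<le> d / 4 * R" using mult_right_mono[OF tail(2) R] by (simp add: mult.assoc)
    also have "- (d / 2) * R + d / 4 * R = - (d / (4 * K)) * (K * R)" using K by (simp add: field_simps)
    also have "\<dots> \<le> - (d / (4 * K)) * Q" using QR d K by (intro mult_left_mono_neg) auto
    finally show "(\<Sum>i<n. \<Sum>j<n. (if cos (\<alpha> i - \<alpha> j) > \<tau> then - d / 2 else tail d \<epsilon>) * (v i - v j)\<^sup>2)
      \<le> - (d / (4 * K)) * (\<Sum>i<n. \<Sum>j<n. (v i - v j)\<^sup>2)" by (simp add: Q_def)
  qed
qed

section \<open>Non-synchronized limits\<close>

text \<open>Used with \<open>m = n\<close> and with \<open>m = 5\<close>. All forces are at most
  \<open>n mod m\<close>, so their Euclidean norm is at most \<open>sqrt n * (n mod m)\<close>. The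
  critical point needs this below \<open>n * d\<^sup>2 / (32 * K)\<close>, which is
  \<open>c * n * r / 2\<close> for \<open>c = d / (4 * K)\<close> and \<open>r = d / 4\<close>;
  dividing by \<open>sqrt n\<close> gives \<open>residue\<close>.\<close>

lemma nonsync_start_set:
  fixes n m :: nat and d K \<epsilon> \<tau> :: real
  defines "\<alpha> \<equiv> (\<lambda>i. 2 * pi * real i / real m)"
  assumes m: "2 \<le> m" "m \<le> n" and \<tau>: "0 \<le> \<tau>" "\<tau> < 1" and \<epsilon>: "\<epsilon> > 0" and d: "d > 0" and K: "K > 0"
    and gap: "\<And>i j. i < n \<Longrightarrow> j < n \<Longrightarrow> 2 * d \<le> \<bar>cos (\<alpha> i - \<alpha> j) - \<tau>\<bar>"
    and edges: "\<And>v :: nat \<Rightarrow> real. (\<Sum>i<n. \<Sum>j<n. (v i - v j)\<^sup>2)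
      \<le> K * (\<Sum>i<n. \<Sum>j<n. if cos (\<alpha> i - \<alpha> j) > \<tau> then (v i - v j)\<^sup>2 else 0)"
    and tail: "tail d \<epsilon> \<le> d / 2" "tail d \<epsilon> * K \<le> d / 4"
    and residue: "real (n mod m) < d\<^sup>2 / (32 * K) * sqrt (real n)"
  shows "\<exists>A \<in> sets (unif_torus n). emeasure (unif_torus n) A > 0 \<and>
          (\<forall>X0\<in>A. (\<exists>\<gamma>. grad_flow_sol n (obj (phi \<epsilon> \<tau>) n) X0 \<gamma>) \<and>
             (\<forall>\<gamma>. grad_flow_sol n (obj (phi \<epsilon> \<tau>) n) X0 \<gamma> \<longrightarrow>
                (\<exists>Xs. converges_to n \<gamma> Xs \<and>
                      local_max_on_torus n (obj (phi \<epsilon> \<tau>) n) Xs \<and>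
                      \<not> synchronized n Xs)))"
proof -
  have n: "n > 0" using m by simp
  interpret torus_window "phi \<epsilon> \<tau>" "phi1 \<epsilon> \<tau>" "phi2 \<epsilon> \<tau>" "1 / \<epsilon>" n \<alpha> "d / 4" "d / (4 * K)"
    "\<lambda>i j. if cos (\<alpha> i - \<alpha> j) > \<tau> then - d / 2 else tail d \<epsilon>"
    unfolding \<alpha>_def
    by (rule torus_window_polygon[OF n \<tau> \<epsilon> d K gap[unfolded \<alpha>_def] edges[unfolded \<alpha>_def] tail])
  \<comment> \<open>The pair force as a function of the index difference; a full turn is the period
    \<open>m\<close>.\<close>
  define G where "G x = - (phi1 \<epsilon> \<tau> (cos (2 * pi * x / m)) * sin (2 * pi * x / m))" for x
  have force_le: "\<bar>force n i \<alpha>\<bar> \<le> real (n mod m)" for i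
  proof -
    have "force n i \<alpha> = (\<Sum>j<n. G (real i - real j))"
      by (simp add: force_def G_def \<alpha>_def diff_divide_distrib right_diff_distrib)
    moreover have "\<bar>\<Sum>j<n. G (real i - real j)\<bar> \<le> real (n mod m)"
    proof (rule abs_sum_odd_periodic_le)
      show "m > 0" using m by simp
      have "2 * pi * (x - real m) / m = 2 * pi * x / m - 2 * pi" for x
        using m by (simp add: field_simps)
      then show "G (x - real m) = G x" for x by (simp add: G_def cos_diff sin_diff)
      show "G (- x) = - G x" for x by (simp add: G_def)
      show "\<bar>G x\<bar> \<le> 1" for x
        using mult_mono[OF \<phi>1_le abs_sin_le_one, of "2 * pi * x / m" "cos (2 * pi * x / m)"]
        by (simp add: G_def abs_mult)
    qed
    ultimately show ?thesis by simp
  qed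
  define \<gamma> where "\<gamma> = sqrt (real n) * real (n mod m)"
  have "(\<Sum>i<n. (force n i \<alpha>)\<^sup>2) \<le> (\<Sum>i<n. (real (n mod m))\<^sup>2)"
    using force_le by (intro sum_mono) (metis abs_le_square_iff abs_of_nat)
  also have "\<dots> = \<gamma>\<^sup>2" by (simp add: \<gamma>_def power_mult_distrib)
  finally have grad: "(\<Sum>i<n. (force n i \<alpha>)\<^sup>2) \<le> \<gamma>\<^sup>2" .
  have "\<gamma> < sqrt (real n) * (d\<^sup>2 / (32 * K) * sqrt (real n))"
    unfolding \<gamma>_def using residue n by (intro mult_strict_left_mono) auto
  also have "\<dots> = d / (4 * K) * n * (d / 4) / 2"
    by (simp add: power2_eq_square)
  finally have \<gamma>: "\<gamma> < d / (4 * K) * n * (d / 4) / 2" .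
  have "\<gamma> \<ge> 0" by (simp add: \<gamma>_def)
  then obtain \<theta>s where \<theta>s: "\<And>i. i < n \<Longrightarrow> \<bar>\<theta>s i - \<alpha> i\<bar> \<le> d / 4" and crit: "\<And>v. slope n \<theta>s v = 0"
    using critical_point_near[OF grad _ \<gamma>] by blast
  \<comment> \<open>Vertex \<open>k\<close> is opposite or nearly opposite to vertex 0, at an angle
    between \<open>pi / 2\<close> and \<open>pi\<close>. So the pair is a non-edge and stays apart
    at the critical point.\<close>
  define k where "k = m div 2"
  have k: "k < n" "0 < n" using m by (auto simp: k_def)
  have "cos (\<alpha> k - \<alpha> 0) \<le> 0"
  proof -
    have "m \<le> 4 * k" "2 * k \<le> m" using m unfolding k_def by linarith+
    then have "real m \<le> 4 * real k" "2 * real k \<le> real m" by linarith+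
    then have "pi / 2 \<le> \<alpha> k" "\<alpha> k \<le> pi" using m by (simp_all add: \<alpha>_def field_simps)
    then have "cos (\<alpha> k) \<le> cos (pi / 2)" by (intro cos_monotone_0_pi_le) auto
    then show ?thesis by (simp add: \<alpha>_def)
  qed
  then have "cos (\<alpha> k - \<alpha> 0) \<le> \<tau> - 2 * d" using gap[OF k] \<tau> d by linarith
  moreover have "\<bar>cos (\<theta>s k - \<theta>s 0) - cos (\<alpha> k - \<alpha> 0)\<bar> \<le> d"
    using abs_cos_diff_le[of "\<theta>s k - \<theta>s 0" "\<alpha> k - \<alpha> 0"] \<theta>s[OF k(1)] \<theta>s[OF k(2)] d by linarith
  ultimately have cos: "cos (\<theta>s k - \<theta>s 0) < 1" using \<tau> d by linarith
  define \<delta> where "\<delta> = d / 4 / (2 * (real n + 1))"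
  have \<delta>: "\<delta> > 0" using d by (simp add: \<delta>_def)
  let ?A = "PiE {..<n} (\<lambda>i. circ ` {\<theta>s i - \<delta> .. \<theta>s i + \<delta>})"
  show ?thesis
  proof (intro bexI[of _ ?A] conjI ballI allI impI)
    fix X0 assume "X0 \<in> ?A"
    then have X0: "X0 i \<in> circ ` {\<theta>s i - \<delta> .. \<theta>s i + \<delta>}" if "i < n" for i
      using that by (auto simp: PiE_iff)
    show "\<exists>\<gamma>. grad_flow_sol n (obj (phi \<epsilon> \<tau>) n) X0 \<gamma>" by (rule grad_flow_limit(1)[OF \<theta>s crit X0[unfolded \<delta>_def] k cos])
    show "\<exists>Xs. converges_to n \<gamma> Xs \<and> local_max_on_torus n (obj (phi \<epsilon> \<tau>) n) Xs \<and> \<not> synchronized n Xs"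
      if "grad_flow_sol n (obj (phi \<epsilon> \<tau>) n) X0 \<gamma>" for \<gamma>
      by (rule grad_flow_limit(2)[OF \<theta>s crit X0[unfolded \<delta>_def] k cos that])
  qed (use emeasure_unif_torus_box[OF \<delta>] in auto)
qed

section \<open>Geometry of the pentagon and choice of the parameters\<close>

lemma cos_fifth_pos: "0 < cos (2 * pi / 5)"
  by (rule cos_gt_zero) auto

text \<open>No cosine of the pentagon lies strictly between 0 and \<open>cos (2 * pi / 5)\<close>;
  the threshold is placed in this gap.\<close>

lemma cos_pentagon:
  fixes x :: int
  shows "x mod 5 \<in> {0, 1, 4} \<Longrightarrow> cos (2 * pi * of_int x / 5) \<ge> cos (2 * pi / 5)"
    and "x mod 5 \<notin> {0, 1, 4} \<Longrightarrow> cos (2 * pi * of_int x / 5) \<le> 0"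
proof -
  have red: "cos (2 * pi * of_int x / 5) = cos (2 * pi * of_int (x mod 5) / 5)"
  proof -
    have "of_int x = (of_int (x mod 5) + 5 * of_int (x div 5) :: real)"
      by (metis add.commute mult_div_mod_eq of_int_add of_int_mult of_int_numeral)
    then have "2 * pi * of_int x / 5 = 2 * pi * of_int (x mod 5) / 5 + 2 * pi * of_int (x div 5)"
      by (simp add: field_simps)
    then show ?thesis by (simp only: cos_add cos_int_2pin sin_int_2pin)
  qed
  have c4: "cos (2 * pi * 4 / 5) = cos (2 * pi / 5)"
    using cos_2pi_minus[of "2 * pi / 5"] by (simp add: field_simps)
  have c3: "cos (2 * pi * 3 / 5) = cos (2 * pi * 2 / 5)"
    using cos_2pi_minus[of "2 * pi * 2 / 5"] by (simp add: field_simps)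
  have c2: "cos (2 * pi * 2 / 5) \<le> 0"
    using cos_monotone_0_pi_le[of "pi / 2" "2 * pi * 2 / 5"] by simp
  show "x mod 5 \<in> {0, 1, 4} \<Longrightarrow> cos (2 * pi * of_int x / 5) \<ge> cos (2 * pi / 5)"
    unfolding red using c4 by auto
  assume "x mod 5 \<notin> {0, 1, 4}"
  moreover have "0 \<le> x mod 5" "x mod 5 < 5" by auto
  ultimately have "x mod 5 = 2 \<or> x mod 5 = 3" by auto
  then show "cos (2 * pi * of_int x / 5) \<le> 0"
    unfolding red using c2 c3 by auto
qed

text \<open>Non-adjacent vertices of a pentagon are two steps apart, and the vertex between them is
  adjacent to both. Its cluster consists of indices \<open>5 * t + a\<close>, of which at least
  \<open>n div 5\<close> are below \<open>n\<close>.\<close>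

lemma pentagon_common_neighbours:
  assumes \<tau>: "0 \<le> \<tau>" "\<tau> < cos (2 * pi / 5)"
    and nonadj: "\<not> cos (2 * pi * real i / 5 - 2 * pi * real j / 5) > \<tau>"
  shows "n div 5 \<le> card {k\<in>{..<n}. cos (2 * pi * real i / 5 - 2 * pi * real k / 5) > \<tau> \<and>
    cos (2 * pi * real k / 5 - 2 * pi * real j / 5) > \<tau>}"
proof -
  have adj: "cos (2 * pi * real i / 5 - 2 * pi * real j / 5) > \<tau>"
    if "(int i - int j) mod 5 \<in> {0, 1, 4}" for i j
  proof -
    have eq: "2 * pi * real i / 5 - 2 * pi * real j / 5 = 2 * pi * of_int (int i - int j) / 5"
      by (simp add: field_simps)
    show ?thesis unfolding eq using cos_pentagon(1)[OF that] \<tau> by linarith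
  qed
  have "(int i - int j) mod 5 \<notin> {0, 1, 4}" using nonadj by (rule contrapos_nn) (rule adj)
  then have "(int i - int j) mod 5 = 2 \<or> (int i - int j) mod 5 = 3" by force
  \<comment> \<open>The vertex between them is \<open>j + 1\<close> or \<open>j - 1\<close>, the
    latter written as \<open>j + 4\<close> modulo 5.\<close>
  then have "\<exists>a<5. \<forall>t. (int i - int (5 * t + a)) mod 5 \<in> {1, 4} \<and> (int (5 * t + a) - int j) mod 5 \<in> {1, 4}"
  proof
    assume "(int i - int j) mod 5 = 2"
    then show ?thesis by (intro exI[of _ "(j + 1) mod 5"]) (auto; presburger)
  next
    assume "(int i - int j) mod 5 = 3"
    then show ?thesis by (intro exI[of _ "(j + 4) mod 5"]) (auto; presburger)
  qed
  then obtain a where a: "a < 5" and at: "\<And>t. (int i - int (5 * t + a)) mod 5 \<in> {1, 4}"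
    "\<And>t. (int (5 * t + a) - int j) mod 5 \<in> {1, 4}" by blast
  have "(\<lambda>t. 5 * t + a) ` {..<n div 5} \<subseteq> {k\<in>{..<n}. cos (2 * pi * real i / 5 - 2 * pi * real k / 5) > \<tau> \<and>
    cos (2 * pi * real k / 5 - 2 * pi * real j / 5) > \<tau>}" (is "_ \<subseteq> ?S")
  proof safe
    fix t assume "t < n div 5"
    then show "5 * t + a < n" using a by linarith
  qed (use adj at in blast)+
  then have "card ((\<lambda>t. 5 * t + a) ` {..<n div 5}) \<le> card ?S"
    by (intro card_mono) auto
  moreover have "card ((\<lambda>t. 5 * t + a) ` {..<n div 5}) = n div 5"
    by (subst card_image) (auto simp: inj_on_def)
  ultimately show ?thesis by simp
qed

lemma cos_gap_exists:
  fixes \<alpha> :: "nat \<Rightarrow> real"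
  assumes "\<And>i j. i < n \<Longrightarrow> j < n \<Longrightarrow> cos (\<alpha> i - \<alpha> j) \<noteq> \<tau>"
  shows "\<exists>d>0. \<forall>i<n. \<forall>j<n. 2 * d \<le> \<bar>cos (\<alpha> i - \<alpha> j) - \<tau>\<bar>"
proof -
  let ?S = "(\<lambda>(i, j). \<bar>cos (\<alpha> i - \<alpha> j) - \<tau>\<bar>) ` ({..<n} \<times> {..<n})"
  \<comment> \<open>The inserted 1 makes the minimum meaningful for \<open>n = 0\<close>
    too.\<close>
  have fin: "finite (insert 1 ?S)" by simp
  define e where "e = Min (insert 1 ?S)"
  have "e \<in> insert 1 ?S" unfolding e_def by (rule Min_in[OF fin]) simp
  then have "e > 0" using assms by auto
  moreover have "e \<le> \<bar>cos (\<alpha> i - \<alpha> j) - \<tau>\<bar>" if "i < n" "j < n" for i j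
    unfolding e_def by (rule Min_le[OF fin]) (use that in auto)
  ultimately show ?thesis by (intro exI[of _ "e / 2"]) auto
qed

text \<open>Consecutive vertices are \<open>2 * pi / n\<close> apart, at most
  \<open>2 * pi / 5\<close> because \<open>n \<ge> 5\<close>; so the path through all indices
  consists of edges.\<close>

lemma polygon_sum_sq_diff_le:
  assumes n: "n \<ge> 5" and \<tau>: "\<tau> < cos (2 * pi / 5)"
  shows "(\<Sum>i<n. \<Sum>j<n. (v i - v j)\<^sup>2) \<le> 4 * real n ^ 4 *
    (\<Sum>i<n. \<Sum>j<n. if cos (2 * pi * real i / n - 2 * pi * real j / n) > \<tau> then (v i - v j)\<^sup>2 else 0)"
proof (rule sum_sq_diff_le_path)
  fix k assume "Suc k < n"
  have "2 * pi * real (Suc k) / n - 2 * pi * real k / n = 2 * pi / n"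
    by (simp add: diff_divide_distrib[symmetric] algebra_simps)
  moreover have "cos (2 * pi / 5) \<le> cos (2 * pi / n)"
    using n by (intro cos_monotone_0_pi_le) (auto simp: field_simps)
  ultimately show "cos (2 * pi * real (Suc k) / n - 2 * pi * real k / n) > \<tau>" using \<tau> by simp
qed

theorem mainTheorem3:
  shows "\<exists>\<epsilon>>0. \<exists>\<tau>. -1 < \<tau> \<and> \<tau> < 1 \<and>
    (\<forall>n\<ge>5.
       (\<exists>A \<in> sets (unif_torus n). emeasure (unif_torus n) A > 0 \<and>
          (\<forall>X0\<in>A. (\<exists>\<gamma>. grad_flow_sol n (obj (phi \<epsilon> \<tau>) n) X0 \<gamma>) \<and>
             (\<forall>\<gamma>. grad_flow_sol n (obj (phi \<epsilon> \<tau>) n) X0 \<gamma> \<longrightarrow>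
                (\<exists>Xs. converges_to n \<gamma> Xs \<and>
                      local_max_on_torus n (obj (phi \<epsilon> \<tau>) n) Xs \<and>
                      \<not> synchronized n Xs)))))"
proof -
  define a where "a = cos (2 * pi / 5)"
  have a: "0 < a" "a \<le> 1" using cos_fifth_pos by (auto simp: a_def)
  \<comment> \<open>The threshold will lie in the middle third of the interval from 0 to
    \<open>a\<close>, hence at distance at least \<open>a / 3 = 2 * d5\<close> from every pentagon
    cosine. This fixes \<open>d5\<close> before \<open>\<tau>\<close>.\<close>
  define d5 where "d5 = a / 6"
  \<comment> \<open>This is \<open>4 * B + 1\<close> for \<open>B = 10\<close>.\<close>
  define K5 :: real where "K5 = 41"
  have d5: "d5 > 0" using a by (simp add: d5_def)
  \<comment> \<open>From \<open>N\<close> on, \<open>sqrt n\<close> is large enough for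
    \<open>residue\<close> with the largest remainder modulo 5, which is 4.\<close>
  obtain N where N: "(4 / (d5\<^sup>2 / (32 * K5)))\<^sup>2 < real N" using reals_Archimedean2 by blast
  define S where "S = (\<Union>n\<in>{..<N}. (\<lambda>(i, j). cos (2 * pi * real i / n - 2 * pi * real j / n)) ` ({..<n} \<times> {..<n}))"
  have "finite S" unfolding S_def by auto
  moreover have "infinite {a / 3<..<2 * a / 3}" using a by (intro infinite_Ioo) auto
  ultimately have "\<not> {a / 3<..<2 * a / 3} \<subseteq> S" using finite_subset by blast
  then obtain \<tau> where "\<tau> \<in> {a / 3<..<2 * a / 3}" "\<tau> \<notin> S" by blast
  then have \<tau>: "a / 3 < \<tau>" "\<tau> < 2 * a / 3" "\<tau> \<notin> S" by simp_all
  have \<tau>0: "0 \<le> \<tau>" "\<tau> < 1" "\<tau> < cos (2 * pi / 5)" using \<tau> a unfolding a_def by linarith+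
  have "\<exists>d>0. \<forall>i<n. \<forall>j<n. 2 * d \<le> \<bar>cos (2 * pi * real i / n - 2 * pi * real j / n) - \<tau>\<bar>" if "n < N" for n
    using \<tau>(3) that by (intro cos_gap_exists) (force simp: S_def)
  then obtain d where d: "\<And>n. n < N \<Longrightarrow> d n > 0"
    "\<And>n i j. n < N \<Longrightarrow> i < n \<Longrightarrow> j < n \<Longrightarrow> 2 * d n \<le> \<bar>cos (2 * pi * real i / n - 2 * pi * real j / n) - \<tau>\<bar>"
    by metis
  have ev: "\<forall>\<^sub>F \<epsilon> in at_right 0. tail d \<epsilon> \<le> d / 2 \<and> tail d \<epsilon> * K \<le> d / 4" if "d > 0" "K > 0" for d K :: real
  proof -
    have "\<forall>\<^sub>F \<epsilon> in at_right 0. tail d \<epsilon> < min (d / 2) (d / (4 * K))"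
      using tail_tendsto_0[OF that(1)] that by (intro order_tendstoD(2)) auto
    then show ?thesis
      by (rule eventually_mono) (use that in \<open>auto simp: field_simps\<close>)
  qed
  \<comment> \<open>The gaps \<open>d n\<close> vary with \<open>n\<close>, but only finitely many
    occur, so one small \<open>\<epsilon>\<close> serves them all.\<close>
  have "\<forall>\<^sub>F \<epsilon> in at_right 0. \<forall>n\<in>{5..<N}. tail (d n) \<epsilon> \<le> d n / 2 \<and> tail (d n) \<epsilon> * (4 * real n ^ 4) \<le> d n / 4"
    using d(1) by (intro eventually_ball_finite ballI ev) auto
  moreover have "\<forall>\<^sub>F \<epsilon> in at_right 0. tail d5 \<epsilon> \<le> d5 / 2 \<and> tail d5 \<epsilon> * K5 \<le> d5 / 4"
    using d5 by (intro ev) (auto simp: K5_def)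
  moreover have "\<forall>\<^sub>F \<epsilon>::real in at_right 0. \<epsilon> > 0" by (rule eventually_at_right_less)
  ultimately have "\<forall>\<^sub>F \<epsilon>::real in at_right 0. \<epsilon> > 0 \<and> (tail d5 \<epsilon> \<le> d5 / 2 \<and> tail d5 \<epsilon> * K5 \<le> d5 / 4) \<and>
      (\<forall>n\<in>{5..<N}. tail (d n) \<epsilon> \<le> d n / 2 \<and> tail (d n) \<epsilon> * (4 * real n ^ 4) \<le> d n / 4)"
    by eventually_elim blast
  then obtain \<epsilon> :: real where \<epsilon>: "\<epsilon> > 0" and tail5: "tail d5 \<epsilon> \<le> d5 / 2" "tail d5 \<epsilon> * K5 \<le> d5 / 4"
    and tailn: "\<And>n. n \<in> {5..<N} \<Longrightarrow> tail (d n) \<epsilon> \<le> d n / 2 \<and> tail (d n) \<epsilon> * (4 * real n ^ 4) \<le> d n / 4"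
    using eventually_happens'[OF trivial_limit_at_right_real] by blast
  show ?thesis
  proof (intro exI conjI allI impI)
    show "0 < \<epsilon>" "- 1 < \<tau>" "\<tau> < 1" using \<epsilon> \<tau>0 by auto
    fix n :: nat assume n: "5 \<le> n"
    show "\<exists>A \<in> sets (unif_torus n). emeasure (unif_torus n) A > 0 \<and>
          (\<forall>X0\<in>A. (\<exists>\<gamma>. grad_flow_sol n (obj (phi \<epsilon> \<tau>) n) X0 \<gamma>) \<and>
             (\<forall>\<gamma>. grad_flow_sol n (obj (phi \<epsilon> \<tau>) n) X0 \<gamma> \<longrightarrow>
                (\<exists>Xs. converges_to n \<gamma> Xs \<and>
                      local_max_on_torus n (obj (phi \<epsilon> \<tau>) n) Xs \<and>
                      \<not> synchronized n Xs)))"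
    proof (cases "n < N")
      case True
      \<comment> \<open>One point per vertex: no remainder, hence no residual force.\<close>
      have "real (n mod n) < (d n)\<^sup>2 / (32 * (4 * real n ^ 4)) * sqrt (real n)"
        using d(1)[OF True] n by simp
      then show ?thesis
        by (intro nonsync_start_set[of n n \<tau> \<epsilon> "d n" "4 * real n ^ 4"])
           (use n True \<tau>0 \<epsilon> d tailn polygon_sum_sq_diff_le[OF n \<tau>0(3)] in auto)
    next
      case False
      have gap: "2 * d5 \<le> \<bar>cos (2 * pi * real i / real 5 - 2 * pi * real j / real 5) - \<tau>\<bar>" for i j
      proof -
        have eq: "2 * pi * real i / real 5 - 2 * pi * real j / real 5 = 2 * pi * of_int (int i - int j) / 5"
          by (simp add: field_simps)
        show ?thesis
          unfolding eq using cos_pentagon[of "int i - int j", folded a_def] \<tau>(1,2)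
          by (cases "(int i - int j) mod 5 \<in> {0, 1, 4}"; simp only: d5_def not_True_eq_False not_False_eq_True; linarith)
      qed
      \<comment> \<open>The factor 10 is forced by the worst case \<open>n = 9\<close>, where
        \<open>n div 5 = 1\<close>, up to rounding.\<close>
      have "n \<le> 10 * (n div 5)" "n div 5 > 0" using n by presburger+
      then have edges: "(\<Sum>i<n. \<Sum>j<n. (v i - v j)\<^sup>2)
        \<le> K5 * (\<Sum>i<n. \<Sum>j<n. if cos (2 * pi * real i / real 5 - 2 * pi * real j / real 5) > \<tau> then (v i - v j)\<^sup>2 else 0)"
        for v :: "nat \<Rightarrow> real"
        using sum_sq_diff_le_common_neighbours[of n "\<lambda>i j. cos (2 * pi * real i / real 5 - 2 * pi * real j / real 5) > \<tau>" "n div 5" 10 v]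
          pentagon_common_neighbours[OF \<tau>0(1,3)] by (simp add: K5_def)
      have "4 / (d5\<^sup>2 / (32 * K5)) < sqrt (real n)"
        using N False by (intro real_less_rsqrt) auto
      moreover have pos: "d5\<^sup>2 / (32 * K5) > 0" using d5 by (simp add: K5_def)
      ultimately have "4 < sqrt (real n) * (d5\<^sup>2 / (32 * K5))"
        by (simp only: pos_divide_less_eq[OF pos])
      moreover have "real (n mod 5) \<le> 4" using mod_less_divisor[of 5 n] by linarith
      ultimately have residue: "real (n mod 5) < d5\<^sup>2 / (32 * K5) * sqrt (real n)" by (simp only: mult.commute)
      show ?thesis
        by (rule nonsync_start_set[of 5 n \<tau> \<epsilon> d5 K5])
           (use n \<tau>0 \<epsilon> d5 gap edges tail5 residue in \<open>auto simp: K5_def\<close>)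
    qed
  qed
qed

end
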